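(* Let $\mathcal{S}$ be the set of all real $5\times 5$ completely pivoted matrices $A$ of the form $$A=\begin{bmatrix} 1 & 1 & a_{13} & a_{14} & a_{15}\\ x & a_{22} & a_{23} & -1 & 1\\ -1 & a_{32} & a_{33} & -1 & -1\\ y & a_{42} & 1 & 1 & 1\\ z & -1 & 1 & -1 & 1\end{bmatrix}$$ (with $x,y,z,a_{13},a_{14},a_{15},a_{22},a_{23},a_{32},a_{33},a_{42}$ arbitrary reals) whose Gaussian elimination matrices satisfy the equalities $$A^{(2)}_{32}=A^{(2)}_{22},\quad A^{(2)}_{34}=-A^{(2)}_{22},\quad A^{(2)}_{43}=A^{(2)}_{22},\quad A^{(2)}_{52}=-A^{(2)}_{22},$$ $$A^{(3)}_{35}=-A^{(3)}_{33},\quad A^{(3)}_{43}=A^{(3)}_{33},\quad A^{(3)}_{54}=-A^{(3)}_{33},$$ $$A^{(4)}_{45}=A^{(4)}_{44},\quad A^{(4)}_{54}=-A^{(4)}_{44},\quad A^{(4)}_{55}=A^{(4)}_{44}.$$ Then the largest growth factor $\max_{A\in\mathcal{S}} g(A)$ is exactly the real root of the polynomial $P_5$ (defined in the context) that is approximately $4.1325170786\ldots$, namely the unique real root of $P_5$ in the interval $(4,5)$.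
   Context: For a real $n\times n$ matrix $A$ and $k=1,\dots,n$, set $A^{(k)} := A_{k:n,k:n} - A_{k:n,1:k-1}\,[A_{1:k-1,1:k-1}]^{-1} A_{1:k-1,k:n}$, where $A_{i:j,k:\ell}$ is the submatrix with rows $i,\dots,j$ and columns $k,\dots,\ell$; the entries of $A^{(k)}$ are indexed by $i,j\in\{k,\dots,n\}$ (so $A^{(1)}=A$ and $A^{(k)}$ is the matrix remaining after $k-1$ steps of Gaussian elimination; the relevant leading principal submatrices are assumed invertible). $A$ is completely pivoted if $|A^{(k)}_{i,j}|\le |A^{(k)}_{k,k}|$ for all $i,j=k,\dots,n$, $k=1,\dots,n-1$. For such $A=LU$ ($L$ unit lower triangular, $U$ upper triangular with $U_{kk}=A^{(k)}_{kk}$) the growth factor is $g(A)=\max\{\|L\|_{\max},\|U\|_{\max}/\|A\|_{\max}\}$, $\|\cdot\|_{\max}$ denoting the largest absolute value of an entry. $P_5(g)=\sum_{k=0}^{61} c_k g^k$ with integer coefficients: $c_0=-400768351683901408958416200638054732473753927680$, $c_1=4485865416851125743788230145233574388718469382144$, $c_2=-24514764764411504983475981567602588918013382098944$, $c_3=87217226729799564487654554570961532637620826275840$, $c_4=-227272096308101830763401243729746552751035059798016$, $c_5=462709819431332579135613503090210881152929786494976$, $c_6=-766717614581304313114392121166832616680006210289664$, $c_7=1063584436778076241182112335678621890599851466424320$, $c_8=-1260890928707415271320049672620311457803946132766720$, $c_9=1297738577606655379676433338360545479999727889022976$, $c_{10}=-1174034757320339655369158795901049591606791293108224$, $c_{11}=942963464577089526044422206269395994977092205805568$,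 $c_{12}=-677934188506657333601022620611924661223810387673088$, $c_{13}=439257245648213960218425406267346647338070336077824$, $c_{14}=-257972856502979631073226298004753211978646395289600$, $c_{15}=137990608561232610866439277823535118550017691877376$, $c_{16}=-67501782245716434625321022717049489901181623861248$, $c_{17}=30300948936890380444641188810690357840398421852160$, $c_{18}=-12517004528640474114410312100200354935951234957312$, $c_{19}=4769063904740641993461152447863884474835999391744$, $c_{20}=-1678801195187379807996886928950958962405971853312$, $c_{21}=546626688596819879421936148562972655095260381184$, $c_{22}=-164708488081737671005260911304389856200929312768$, $c_{23}=45913441353285356544812597189623621359713124352$, $c_{24}=-11824394908442237813782015042429910964838072320$, $c_{25}=2805505141981336865142529528869875207720927232$, $c_{26}=-610122837879497813508978054510894441606152192$, $c_{27}=120517644367496052573488222809065538013102080$, $c_{28}=-21259613889629901444312810746680889153945600$, $c_{29}=3232473902649233225492038672001558428778496$, $c_{30}=-385658581119287455693748758468032752254976$, $c_{31}=22806308021126342831010091967753643622400$, $c_{32}=4894535361089103056466100216447232901120$, $c_{33}=-2321369271980741328279078542236324986880$, $c_{34}=601696561599723882176326969201384226816$, $c_{35}=-123775438994232337878919408695562469376$, $c_{36}=21961720969887997312065520856381521920$, $c_{37}=-3468454832875402800794241505433747456$, $c_{38}=494585628535060280610858619094695936$, $c_{39}=-64096987281967089485798296793382912$, $c_{40}=7566621187666403129807306257072128$, $c_{41}=-812991033858742708150732650971136$, $c_{42}=79218174622382297258263303946240$, $c_{43}=-6951821319653222073914715275264$, $c_{44}=542828623292663115763310526464$, $c_{45}=-36902811774200980940618924032$,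 $c_{46}=2088035191940616804066754560$, $c_{47}=-86850177265000967745748992$, $c_{48}=1176129227591098999291904$, $c_{49}=223725965850750547116032$, $c_{50}=-29310655078216507848704$, $c_{51}=2327920657178572930048$, $c_{52}=-143068110048321554432$, $c_{53}=7211069563930583552$, $c_{54}=-302975406829565568$, $c_{55}=10602327706308288$, $c_{56}=-305386806375072$, $c_{57}=7079217962544$, $c_{58}=-127283265864$, $c_{59}=1668783060$, $c_{60}=-14211126$, $c_{61}=59049$. *)

theory Defs
  imports "HOL-Computational_Algebra.Polynomial"
begin

text \<open>Real matrices are represented as functions nat \<Rightarrow> nat \<Rightarrow> real,
  indexed (as in the paper) by 1..n; entries outside 1..n are irrelevant.\<close>

type_synonym rmat = "nat \<Rightarrow> nat \<Rightarrow> real"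

definition is_lead_inv :: "rmat \<Rightarrow> nat \<Rightarrow> rmat \<Rightarrow> bool" where
  "is_lead_inv A m B \<longleftrightarrow>
     (\<forall>p\<in>{1..m}. \<forall>q\<in>{1..m}. (\<Sum>r=1..m. A p r * B r q) = (if p = q then 1 else 0)) \<and>
     (\<forall>p\<in>{1..m}. \<forall>q\<in>{1..m}. (\<Sum>r=1..m. B p r * A r q) = (if p = q then 1 else 0))"

definition lead_invertible :: "rmat \<Rightarrow> nat \<Rightarrow> bool" where
  "lead_invertible A m \<longleftrightarrow> (\<exists>B. is_lead_inv A m B)"

definition lead_inv :: "rmat \<Rightarrow> nat \<Rightarrow> rmat" where
  "lead_inv A m = (THE B. is_lead_inv A m B \<and>
      (\<forall>p q. p \<notin> {1..m} \<or> q \<notin> {1..m} \<longrightarrow> B p q = 0))"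

text \<open>A^{(k)} = A_{k:n,k:n} - A_{k:n,1:k-1} [A_{1:k-1,1:k-1}]^{-1} A_{1:k-1,k:n},
  entries indexed by i,j \<in> {k..n}.\<close>
definition schur :: "rmat \<Rightarrow> nat \<Rightarrow> rmat" where
  "schur A k i j = A i j -
     (\<Sum>p=1..k-1. \<Sum>q=1..k-1. A i p * lead_inv A (k-1) p q * A q j)"

definition completely_pivoted :: "nat \<Rightarrow> rmat \<Rightarrow> bool" where
  "completely_pivoted n A \<longleftrightarrow>
     (\<forall>k\<in>{1..n-1}. \<forall>i\<in>{k..n}. \<forall>j\<in>{k..n}. \<bar>schur A k i j\<bar> \<le> \<bar>schur A k k k\<bar>)"

definition max_norm :: "nat \<Rightarrow> rmat \<Rightarrow> real" where
  "max_norm n M = Max {\<bar>M i j\<bar> | i j. i \<in> {1..n} \<and> j \<in> {1..n}}"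

definition is_LU :: "nat \<Rightarrow> rmat \<Rightarrow> rmat \<Rightarrow> rmat \<Rightarrow> bool" where
  "is_LU n A L U \<longleftrightarrow>
     (\<forall>i j. i \<notin> {1..n} \<or> j \<notin> {1..n} \<longrightarrow> L i j = 0 \<and> U i j = 0) \<and>
     (\<forall>i\<in>{1..n}. L i i = 1) \<and>
     (\<forall>i\<in>{1..n}. \<forall>j\<in>{1..n}. i < j \<longrightarrow> L i j = 0) \<and>
     (\<forall>i\<in>{1..n}. \<forall>j\<in>{1..n}. j < i \<longrightarrow> U i j = 0) \<and>
     (\<forall>i\<in>{1..n}. \<forall>j\<in>{1..n}. A i j = (\<Sum>r=1..n. L i r * U r j))"

definition LU_factors :: "nat \<Rightarrow> rmat \<Rightarrow> rmat \<times> rmat" where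
  "LU_factors n A = (THE (L, U). is_LU n A L U)"

definition growth_factor :: "nat \<Rightarrow> rmat \<Rightarrow> real" where
  "growth_factor n A = (let (L, U) = LU_factors n A in
      max (max_norm n L) (max_norm n U / max_norm n A))"

definition S5 :: "rmat set" where
  "S5 = {A.
     A 1 1 = 1 \<and> A 1 2 = 1 \<and>
     A 2 4 = -1 \<and> A 2 5 = 1 \<and>
     A 3 1 = -1 \<and> A 3 4 = -1 \<and> A 3 5 = -1 \<and>
     A 4 3 = 1 \<and> A 4 4 = 1 \<and> A 4 5 = 1 \<and>
     A 5 2 = -1 \<and> A 5 3 = 1 \<and> A 5 4 = -1 \<and> A 5 5 = 1 \<and>
     (\<forall>m\<in>{1..4}. lead_invertible A m) \<and>
     completely_pivoted 5 A \<and>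
     schur A 2 3 2 = schur A 2 2 2 \<and> schur A 2 3 4 = - schur A 2 2 2 \<and>
     schur A 2 4 3 = schur A 2 2 2 \<and> schur A 2 5 2 = - schur A 2 2 2 \<and>
     schur A 3 3 5 = - schur A 3 3 3 \<and> schur A 3 4 3 = schur A 3 3 3 \<and>
     schur A 3 5 4 = - schur A 3 3 3 \<and>
     schur A 4 4 5 = schur A 4 4 4 \<and> schur A 4 5 4 = - schur A 4 4 4 \<and>
     schur A 4 5 5 = schur A 4 4 4}"

definition P5_coeffs :: "int list" where
  "P5_coeffs = [
   (-400768351683901408958416200638054732473753927680),
   (4485865416851125743788230145233574388718469382144),
   (-24514764764411504983475981567602588918013382098944),
   (87217226729799564487654554570961532637620826275840),
   (-227272096308101830763401243729746552751035059798016),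
   (462709819431332579135613503090210881152929786494976),
   (-766717614581304313114392121166832616680006210289664),
   (1063584436778076241182112335678621890599851466424320),
   (-1260890928707415271320049672620311457803946132766720),
   (1297738577606655379676433338360545479999727889022976),
   (-1174034757320339655369158795901049591606791293108224),
   (942963464577089526044422206269395994977092205805568),
   (-677934188506657333601022620611924661223810387673088),
   (439257245648213960218425406267346647338070336077824),
   (-257972856502979631073226298004753211978646395289600),
   (137990608561232610866439277823535118550017691877376),
   (-67501782245716434625321022717049489901181623861248),
   (30300948936890380444641188810690357840398421852160),
   (-12517004528640474114410312100200354935951234957312),
   (4769063904740641993461152447863884474835999391744),
   (-1678801195187379807996886928950958962405971853312),
   (546626688596819879421936148562972655095260381184),
   (-164708488081737671005260911304389856200929312768),
   (45913441353285356544812597189623621359713124352),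
   (-11824394908442237813782015042429910964838072320),
   (2805505141981336865142529528869875207720927232),
   (-610122837879497813508978054510894441606152192),
   (120517644367496052573488222809065538013102080),
   (-21259613889629901444312810746680889153945600),
   (3232473902649233225492038672001558428778496),
   (-385658581119287455693748758468032752254976),
   (22806308021126342831010091967753643622400),
   (4894535361089103056466100216447232901120),
   (-2321369271980741328279078542236324986880),
   (601696561599723882176326969201384226816),
   (-123775438994232337878919408695562469376),
   (21961720969887997312065520856381521920),
   (-3468454832875402800794241505433747456),
   (494585628535060280610858619094695936),
   (-64096987281967089485798296793382912),
   (7566621187666403129807306257072128),
   (-812991033858742708150732650971136),
   (79218174622382297258263303946240),
   (-6951821319653222073914715275264),
   (542828623292663115763310526464),
   (-36902811774200980940618924032),
   (2088035191940616804066754560),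
   (-86850177265000967745748992),
   (1176129227591098999291904),
   (223725965850750547116032),
   (-29310655078216507848704),
   (2327920657178572930048),
   (-143068110048321554432),
   (7211069563930583552),
   (-302975406829565568),
   (10602327706308288),
   (-305386806375072),
   (7079217962544),
   (-127283265864),
   (1668783060),
   (-14211126),
   (59049)]"

definition P5 :: "real poly" where
  "P5 = Poly (map of_int P5_coeffs)"

end

theory Submission
  imports Defs "HOL-Analysis.Analysis"
begin

text \<open>
  Write \<open>c = a\<^sub>1\<^sub>4\<close>, let \<open>s\<close> be the fourth pivot and put \<open>s = 2 + 2k\<close>. The ten equalities determine all
  other entries rationally in \<open>c\<close> and \<open>k\<close> and leave one polynomial equation \<open>F(c, k) = 0\<close>
  (\<open>curveF\<close>) of bidegree (10, 7); the last pivot is \<open>2s = 4 + 4k\<close>, and it is the growth factor as soon as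
  \<open>k > 0\<close>. Complete pivoting forces \<open>-1 < c < 0\<close> and \<open>N + k(2 - N) < 0\<close> with \<open>N = c(1 + c)\<close> whenever
  \<open>k > 0\<close>. In that region \<open>F(c, k) > 0\<close> persists when \<open>k\<close> grows, so the largest \<open>k\<close> on
  the curve is attained inside a tiny box, where \<open>\<partial>F/\<partial>c = 0\<close> by maximality, and there all pivoting
  inequalities can be checked. Eliminating \<open>c\<close> from \<open>F = \<partial>F/\<partial>c = 0\<close>, by an explicit combination
  \<open>U F + V \<partial>F/\<partial>c = K\<^sup>8 (1 + K)\<^sup>2 P\<^sub>5(4 + 2K)\<close> with \<open>K = 2k\<close>, gives \<open>P\<^sub>5(4 + 4k) = 0\<close>.
\<close>

section \<open>Integer polynomials as coefficient lists\<close>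

text \<open>Two slices locate the optimum. At \<open>K_lo\<close> the polynomial in \<open>c\<close>
  is positive on (-1, 0) outside a short window, and at \<open>K_hi\<close> it is positive on that
  window. A point of the curve in the admissible region and above \<open>K_lo\<close> therefore lies
  over the window and not above \<open>K_hi\<close>, so compactness is needed only for one rectangle
  and never for a set of matrices. Near a maximum \<open>c\<close> varies like the square root of
  the gap in \<open>K\<close>. This is why \<open>K\<close> is enclosed to within 2^-28 in order to
  confine \<open>c\<close> to a window of width 2^-12. No numerical root of \<open>P5\<close>
  enters: being a root comes from the elimination identity, uniqueness in (4, 5) from a single sign
  change. All large polynomial facts are statements about integer lists, settled by evaluation; a
  sign on an interval becomes positivity of all coefficients after a Moebius substitution. Inverse
  matrices stay out of the algebra: a row of a Schur complement is the row of \<open>A\<close> minus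
  the combination of leading rows that agrees with it in the leading columns.\<close>

fun ev :: "int list \<Rightarrow> real \<Rightarrow> real" where
  "ev [] x = 0"
| "ev (a # l) x = of_int a + x * ev l x"

fun padd :: "int list \<Rightarrow> int list \<Rightarrow> int list" where
  "padd [] ys = ys"
| "padd (x # xs) [] = x # xs"
| "padd (x # xs) (y # ys) = (x + y) # padd xs ys"

fun psmult :: "int \<Rightarrow> int list \<Rightarrow> int list" where
  "psmult a [] = []"
| "psmult a (x # xs) = a * x # psmult a xs"

fun pmult :: "int list \<Rightarrow> int list \<Rightarrow> int list" where
  "pmult [] ys = []"
| "pmult (x # xs) ys = padd (psmult x ys) (0 # pmult xs ys)"

text \<open>Horner's scheme for composition with the linear polynomial
  \<open>a + b * x\<close>.\<close>

fun plin :: "int \<Rightarrow> int \<Rightarrow> int list \<Rightarrow> int list" where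
  "plin a b [] = []"
| "plin a b (x # xs) = (let ys = plin a b xs in padd [x] (padd (psmult a ys) (0 # psmult b ys)))"

lemma ev_padd [simp]: "ev (padd xs ys) x = ev xs x + ev ys x"
  by (induction xs ys rule: padd.induct) (auto simp: algebra_simps)

lemma ev_psmult [simp]: "ev (psmult a xs) x = of_int a * ev xs x"
  by (induction xs) (auto simp: algebra_simps)

lemma ev_pmult [simp]: "ev (pmult xs ys) x = ev xs x * ev ys x"
  by (induction xs) (auto simp: algebra_simps)

lemma ev_plin [simp]: "ev (plin a b l) x = ev l (of_int a + of_int b * x)"
  by (induction l) (auto simp: Let_def algebra_simps)

lemma ev_append: "ev (xs @ ys) x = ev xs x + x ^ length xs * ev ys x"
  by (induction xs) (auto simp: algebra_simps)

text \<open>Reversing the coefficients is \<open>x -> 1 / x\<close> up to a power of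
  \<open>x\<close>. The exponent \<open>length l\<close> exceeds the degree by one, hence the factor
  \<open>x\<close> on the right.\<close>

lemma ev_rev: "x \<noteq> 0 \<Longrightarrow> ev (rev l) (1 / x) * x ^ length l = x * ev l x"
  by (induction l) (auto simp: ev_append algebra_simps power_one_over)

lemma poly_Poly_of_int: "poly (Poly (map of_int l)) x = ev l x"
  by (induction l) auto

lemma ev_all_0: "list_all (\<lambda>a. a = 0) l \<Longrightarrow> ev l x = 0"
  by (induction l) auto

lemma ev_nonneg: "list_all (\<lambda>a. 0 < a) l \<Longrightarrow> 0 \<le> x \<Longrightarrow> 0 \<le> ev l x"
  by (induction l) auto

lemma ev_pos: "l \<noteq> [] \<Longrightarrow> list_all (\<lambda>a. 0 < a) l \<Longrightarrow> 0 \<le> x \<Longrightarrow> 0 < ev l x"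
  by (cases l) (auto simp: add_pos_nonneg ev_nonneg)

text \<open>At most one sign change, from minus to plus, as in Descartes' rule. The first
  coefficient that is not negative may be zero; all later ones have to be positive.\<close>

fun neg_then_pos :: "int list \<Rightarrow> bool" where
  "neg_then_pos [] = True"
| "neg_then_pos (a # l) = (if a < 0 then neg_then_pos l else list_all (\<lambda>b. 0 < b) l)"

lemma ev_mono_of_pos:
  "list_all (\<lambda>a. 0 < a) l \<Longrightarrow> 0 \<le> x \<Longrightarrow> x \<le> y \<Longrightarrow> ev l x \<le> ev l y"
proof (induction l)
  case (Cons a l)
  then show ?case
    using ev_nonneg[of l x] by (auto intro!: mult_mono)
qed auto

text \<open>If \<open>a + x * l(x)\<close> is nonnegative with \<open>a < 0\<close>, then
  \<open>l(x) > 0\<close>, so the tail again satisfies the hypotheses. Peeling off the negative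
  coefficients one by one leaves a polynomial without negative coefficients, which is
  monotone.\<close>

lemma ev_mono_of_neg_then_pos:
  "neg_then_pos l \<Longrightarrow> 0 < x \<Longrightarrow> x \<le> y \<Longrightarrow> 0 \<le> ev l x \<Longrightarrow> ev l x \<le> ev l y"
proof (induction l)
  case (Cons a l)
  show ?case
  proof (cases "a < 0")
    case True
    with Cons.prems have "0 < x * ev l x" by (simp add: add_increasing2 not_less)
    with Cons.prems have "0 < ev l x" by (simp add: zero_less_mult_iff)
    with Cons True show ?thesis by (auto intro!: mult_mono)
  next
    case False
    with Cons.prems have "list_all (\<lambda>b. 0 < b) l" by simp
    then have "ev l x \<le> ev l y" "0 \<le> ev l x" using ev_mono_of_pos ev_nonneg Cons.prems by auto
    then show ?thesis using Cons.prems by (auto intro!: mult_mono)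
  qed
qed auto

text \<open>At a root the tail is strictly positive because the constant term is negative. The
  factor \<open>x\<close> in front of the tail then makes the growth beyond the root strict, and no
  second root can follow.\<close>

lemma ev_root_unique:
  assumes "neg_then_pos (a # l)" "a < 0" "0 < x" "0 < y" "ev (a # l) x = 0" "ev (a # l) y = 0"
  shows "x = y"
proof -
  have *: False if "0 < u" "u < v" "ev (a # l) u = 0" "ev (a # l) v = 0" for u v
  proof -
    from that assms have "0 < u * ev l u" "neg_then_pos l" by auto
    then have "0 < ev l u" using that by (simp add: zero_less_mult_iff)
    moreover from this have "ev l u \<le> ev l v"
      using ev_mono_of_neg_then_pos[OF \<open>neg_then_pos l\<close>, of u v] that by simp
    ultimately have "u * ev l u < v * ev l v"
      using that by (intro mult_less_le_imp_less) auto
    with that show False by simp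
  qed
  show ?thesis using *[of x y] *[of y x] assms by (cases x y rule: linorder_cases) auto
qed

section \<open>Clearing denominators, and positivity on rational intervals\<close>

fun pscale :: "int \<Rightarrow> int list \<Rightarrow> int list" where
  "pscale d [] = []"
| "pscale d (x # xs) = x * d ^ length xs # pscale d xs"

text \<open>The homogenized polynomial at \<open>(n, d)\<close>, that is, the value at
  \<open>n / d\<close> times \<open>d\<close> to the power \<open>length l - 1\<close>. For
  \<open>d > 0\<close> the sign at a rational point can thus be read off an integer.\<close>

fun phom :: "int \<Rightarrow> int \<Rightarrow> int list \<Rightarrow> int" where
  "phom n d [] = 0"
| "phom n d (x # xs) = x * d ^ length xs + n * phom n d xs"

text \<open>The extra factor \<open>d\<close> on the left turns the degree into
  \<open>length l\<close> and avoids a truncated subtraction for the empty list.\<close>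

lemma ev_pscale:
  "d \<noteq> 0 \<Longrightarrow> of_int d * ev (pscale d l) x = of_int d ^ length l * ev l (x / of_int d)"
  by (induction l) (auto simp: field_simps)

lemma of_int_phom:
  "d \<noteq> 0 \<Longrightarrow> of_int d * of_int (phom n d l) = of_int d ^ length l * ev l (of_int n / of_int d)"
  by (induction l) (auto simp: field_simps)

text \<open>The substitution \<open>x = 1 / (1 + w)\<close> maps \<open>w \<ge> 0\<close> onto \<open>(0, 1]\<close>, so positive coefficients in \<open>w\<close>
  certify positivity on the interval between \<open>a / d\<close> (excluded) and \<open>(a + b) / d\<close> (included).\<close>

definition pos_on :: "int \<Rightarrow> int \<Rightarrow> int \<Rightarrow> int list \<Rightarrow> bool" where
  "pos_on a b d l \<longleftrightarrow> l \<noteq> [] \<and> 0 < d \<and>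
     (let m = plin 1 1 (rev (plin a b (pscale d l))) in m \<noteq> [] \<and> list_all (\<lambda>x. 0 < x) m)"

lemma ev_pos_on:
  assumes "pos_on a b d l" "0 < x" "x \<le> 1"
  shows "0 < ev l ((of_int a + of_int b * x) / of_int d)"
proof -
  define q where "q = plin a b (pscale d l)"
  have d: "0 < d" and q: "plin 1 1 (rev q) \<noteq> []" "list_all (\<lambda>x. 0 < x) (plin 1 1 (rev q))"
    using assms(1) by (auto simp: pos_on_def q_def Let_def)
  have "0 < ev (plin 1 1 (rev q)) (1 / x - 1)"
    using q assms(2,3) by (intro ev_pos) (auto simp: field_simps)
  then have "0 < ev (rev q) (1 / x)" by simp
  with assms(2) have "0 < ev (rev q) (1 / x) * x ^ length q" by simp
  with ev_rev[of x q] assms(2) have "0 < ev q x" by (simp add: zero_less_mult_iff)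
  then have "0 < of_int d * ev (pscale d l) (of_int a + of_int b * x)" using d by (simp add: q_def)
  then show ?thesis using d by (simp add: ev_pscale zero_less_mult_iff)
qed

section \<open>Uniqueness of the root of the polynomial\<close>

definition P5_shift :: "int list" where "P5_shift = plin 4 2 P5_coeffs"

lemma poly_P5_shift: "poly P5 (4 + 2 * x) = ev P5_shift x"
  by (simp add: P5_def P5_shift_def poly_Poly_of_int)

text \<open>The substitution \<open>x = 1 / (2 + 2 w)\<close> maps \<open>w > 0\<close> onto \<open>0 < x < 1 / 2\<close>; after it there is a single
  sign change, and Descartes' rule applies.\<close>

lemma P5_shift_sign_pattern:
  "let l = psmult (-1) (plin 2 2 (rev P5_shift)) in l \<noteq> [] \<and> hd l < 0 \<and> neg_then_pos l"
  by code_simp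

lemma P5_root_unique:
  assumes "4 < r" "r < 5" "poly P5 r = 0" "4 < s" "s < 5" "poly P5 s = 0"
  shows "r = s"
proof -
  \<comment> \<open>Negated so that the constant coefficient is negative: its sign is opposite to
    that of \<open>P5\<close> at 5.\<close>
  define l where "l = psmult (-1) (plin 2 2 (rev P5_shift))"
  have l: "l \<noteq> []" "hd l < 0" "neg_then_pos l"
    using P5_shift_sign_pattern unfolding l_def Let_def by blast+
  \<comment> \<open>The inverse of \<open>w -> 4 + 1 / (1 + w)\<close>, which maps the positive
    numbers onto (4, 5).\<close>
  define W where "W u = 1 / (u - 4) - 1" for u :: real
  have W: "0 < W u" "ev l (W u) = 0" if "4 < u" "u < 5" "poly P5 u = 0" for u
  proof -
    define x where "x = (u - 4) / 2"
    have u: "u = 4 + 2 * x" by (simp add: x_def field_simps)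
    have "0 < x" "x < 1 / 2" using that by (auto simp: x_def)
    have "ev P5_shift x = 0" using that poly_P5_shift[of x] u by simp
    then have "ev (rev P5_shift) (1 / x) = 0"
      using ev_rev[of x P5_shift] \<open>0 < x\<close> by simp
    moreover have "1 / x = 2 + 2 * W u" using \<open>0 < x\<close> by (simp add: W_def u field_simps)
    ultimately show "ev l (W u) = 0" by (simp add: l_def)
    show "0 < W u" using that by (simp add: W_def field_simps)
  qed
  have "W r = W s"
    using ev_root_unique[of "hd l" "tl l" "W r" "W s"] l W assms by simp
  then show ?thesis using assms by (simp add: W_def)
qed

section \<open>Elimination of the curve parameter\<close>

text \<open>Row \<open>i\<close> lists the coefficients in \<open>K\<close> of \<open>c\<^sup>i\<close> in \<open>8 F(c, K / 2)\<close>.\<close>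

definition FK :: "int list list" where
  "FK = [
   [0, 0, 0, 0, 0, 32, 32, 0],
   [0, 0, 0, 0, 96, 0, -112, -16],
   [0, 0, 0, 144, 48, -88, -8, 16],
   [0, 0, 112, 176, -120, -220, 164, 40],
   [0, 48, 232, -48, -272, 120, 24, -32],
   [8, 136, 100, -162, -194, 303, -62, -41],
   [32, 112, -44, -206, 180, 23, -52, 19],
   [48, 0, -32, -144, 224, -94, -24, 22],
   [32, -32, -24, 8, 44, -50, 16, -2],
   [8, -8, -20, 34, -6, -21, 18, -5],
   [0, 0, -4, 6, 0, -5, 4, -1]]"

text \<open>With \<open>K\<close> fixed this is a univariate polynomial in \<open>c\<close>, so that
  \<open>pderiv\<close> is the partial derivative to be eliminated.\<close>

definition curve :: "real \<Rightarrow> real poly" where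
  "curve x = Poly (map (\<lambda>l. ev l x) FK)"

text \<open>The cofactors \<open>U\<close> and \<open>V\<close> solve the Sylvester system of \<open>F\<close> and its derivative over \<open>\<rat>(K)\<close>. The
  factor \<open>K\<^sup>8 (1 + K)\<^sup>2\<close> on the right-hand side is the least one that makes them polynomial in \<open>K\<close>.\<close>

definition certU :: "int list list" where
  "certU = [
   [0, 0, 0, -2446865858900009449605300224, 63284848805186608037518901248, -522257162999339418102242738176,
    2208180380778575523868011659264, -8006220345953101929774667792384, 63586974479081049051142658457600,
    -348780496283700050140596575141888, 1317819819314393178046466617245696, -1196439173542260230986717068263424,
    -774108623506877489343385185550336, 19248576237317343142577598371987456, 28995464772940459749079442121555968,
    -10782668283978762161801663250169856, 49060309302334548634292436531675136,
    83625267245400391945811284669235200, -138907080471931019628917908695941120,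
    -145708163579689379658407066818576384, 113571464459119484616175121418158080,
    -130738930053773688401633864866332672, -150326690369049330106083848520466432,
    541133097735916472284123255225188352, -92393737286930606584945550290845696,
    -99935263655170012315480875440537600, 422116467310858867614421282906439680,
    -1180969564987195893360434726693765120, 480309637588442758860566386444337152,
    688475994955114166420983121524555776, -827244796912254002650629150406082560,
    1292676490377023910061639776413417472, -959124161486435328626749380568809472,
    -715072366875528859156100935044825088, 1388720417509261950826060722991005696,
    -1007819755894463130242584898883813376, 573207719112612445276975620656463872,
    186807852046768146622829167070150656, -769202253030654800588330167236034560,
    612835426180250135255808670070472704, -265446619946738548314370348037439488,
    93357604183992732280155219077103616, 25952258645404398467113487580528640,
    -98146457032291250327065984503906304, 89375871452098071031950734128054272,
    -61730932734650217355321352082423808, 44256233455100012698916149216149504,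
    -26817457454780406440761717092777984, 13362438806070724186651656785494016,
    -6759128808982141985824122291093504, 3202253609913661231788046405337088, -1248140955727861268130325707358208,
    490818671516083238190602067640320, -199845560289509219284924602777600, 64141009377944506110336707854336,
    -18728391832453407446471068876800, 6922698421933438307209846980608, -1946815624482307150708098465792,
    388089704602922361026812837888, -133695065267750793398697590784, 32282422549361967116389974016,
    -2644231385645395744261144576, 2003677796045587792548331520, -17584875549299273078145024,
    10514553797820317878452224, -6176195276003311500656640, -113776707200473035177984, 676805095312895319736320,
    21473090965708487000064, -118192468620711297024, 354577405862133891072],
   [0, 0, -159578208189131051061215232, 52319891621281921422933884928, -793563086511434882860628049920,
    895733638767435845617158455296, -6166352816535593848559108096000, 56404796204056323679495370309632,
    -447856431386381429203738271154176, 307970715951008860238047399116800, 147712312430789907472494264057856,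
    -13469865005039300746366332608446464, -1332442529640065362089720489705472,
    64676833022714356626388065919696896, 27093166296798368368886750560387072,
    -31149826093849202612439664576954368, 227473127868044436829001433770622976,
    147749051176859790069891604559167488, -551520986146252025565792440619630592,
    -188644171915634142527151681847689216, 336954568585608794457034685224583168,
    -675797893571838819538885380919001088, 31292415885153745418758122247290880,
    1538055615078811757932151430744899584, -500423362010664187142862342641942528,
    49665385987954537030900225358692352, 571226542360462012486403346715901952,
    -3338571263434475510673205296149561344, 2033679235714860054450755774263066624,
    1530254765776553744124437171795918848, -2328995685322933468529787761827250176,
    4048390981245773466324871268116987904, -3928014019101513771347415878078562304,
    -910934731176067053592503221477179392, 3894562676420477016972740172449841152,
    -3610676897588321836024320550861012992, 2520975515300764971671035754158489600,
    -142639429038709609191241376556122112, -1969602989945648184501655221313732608,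
    1957540159825396461119718357576187904, -985373795071277409978425755020820480,
    299507781013968868250879068221734912, 108545118839404712315248998684295168,
    -296330389360947194844630157298237440, 256074927228439227292259518559289344,
    -158691122090393048485387679914000384, 95456838157087315150056533149089792,
    -50827232054490697510075668348534784, 22820348907327225827587510362963968,
    -10315433730677774104566080848527360, 4521201158844986478119691623596032, -1676432671778619185488746281697280,
    605313468472280625462906995081216, -240482960173612544885423295430656, 82037937430728627054950477725696,
    -23166057867360916312961453129728, 8354479923353627220468775780352, -2744103558974890897693256712192,
    639490474567809311875090350080, -194391516527867352208447111168, 62778180900024110483995885568,
    -10883083002029661998171553792, 3235879607525657564936142848, -831824232245412017981095936,
    121782959676637534987747328, -25315092640498243048833024, 5957253536723432235859968,
    -629908950263499759550464, 16612608089466643415040, -9179615062875244068864, -2777523012586715480064],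
   [0, 2353778570789683003152924672, 1537753642549808310226255872, -446124152814743434853240274944,
    -1623998712752570859207088144384, -336033398609400954972945776640, 2076406181956897603281540349952,
    -159223006648299284421884151595008, -1178905795460402387966154543988736, 393349781464841906794258554159104,
    -13248579791363040884031460619583488, -39841246501293836337415054398849024,
    33169094638396737579165774440824832, 94450641084466776883236948060143616,
    -76580303787131910443829776409952256, 93872209318220611483822193681367040,
    607060670046295455107230931632521216, -281136740638381663247269768210677760,
    -898896149922633593008826161647583232, 607789202709859067818311726422556672,
    -96130713430047133668177455662235648, -1710982568349921232731724840691564544,
    1725005242440506756436411997864591360, 1384105678171470123298054764308201472,
    -2037612203807381277099875418838663168, 2660505459646000268887886512816914432,
    -2620824755129115513917562683576549376, -3144747612403598666968638273387233280,
    7079670450432447669458741930017947648, -4586234002764438299577688596689190912,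
    1606340043371577224777387012396154880, 3676410295519864285786042494963679232,
    -9590841937750988472569915192484298752, 7747066637943101111936726894387396608,
    -671280756894680612034185788399812608, -4631052152860120674849700744808890368,
    6876420580741066413522743484284403712, -5972704495626394077359299636922155008,
    2310420085944794543898310018227765248, 872693765279245452478342823126499328,
    -1661578041746218983671573635638755328, 1339117290238894845989776765090791424,
    -1000275719596182218022071983014936576, 654906704895296018403790965715238912,
    -373008070882298275402302980542693376, 241826977878375884788399438758412288,
    -165720479468141864758653166288896000, 94118862040871728496885830304923648,
    -48538857426824387254763476907720704, 25500396152938078954483242969858048,
    -11558871227997208434674842543849472, 4512001866068237676021939762626560, -1915452280571568261703896097882112,
    746217145247298358201225972809728, -217945221107394656742984002830336, 71516259719810289657193668018176,
    -26907222458823727200268110004224, 6137799061939382706066599968768, -1290450475445234907308701515776,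
    540024325427059654431571181568, -87083369306020861369034735616, 6149982216685949753596313600,
    -7810205460774518196394786816, -572720016930544520561426432, -44244089458138023716716544,
    28366652835931820352602112, 5137222678232289698119680, -2863160751933817154961408, -351876853870778564739072,
    1004635983276046024704, 620510460258734309376],
   [864381961024459859914915840, 2105948777768684022338158592, -97022039421717160758750478336,
    -1979351577095914573449396224000, 991112823558160451241806659584, -13971899863355540911822450196480,
    43007213381822857304532630634496, -1173568843089595953204753892114432, 183659398969394932602307084288000,
    -7792184180800755700403173366693888, -34401660713341350128242302423924736,
    -35702884594802832789719632507305984, 77735972670156023803609462098362368,
    11401890980570671069328346007470080, -101390258401080144655082094757675008,
    349741930956934203376674312959295488, 531412063552883831393048157518561280,
    -900147472567036926032003549890609152, -500342720478847842304606464750125056,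
    1188837244980633894403135205011357696, -1110988069484910094918806416092299264,
    -1146175188671443321689532164760141824, 3040708343018200942085189537999355904,
    67855478413093406308677044609744896, -2644839970189595863706507979465424896,
    3541397307528379946478207780433952768, -4839152976788297688384373712048095232,
    -1504199933315179228622469188733108224, 11128189035864712894261348785392189440,
    -11418603519190178329821740804794744832, 6785235909635485472524380321253163008,
    1222575440506029683641611237751521280, -14016122303958007876931860691238780928,
    18770719605232212350381767053734313984, -10543139648357639531342950740202094592,
    -458922527502173167311536915480576000, 8641798802884763438657960697992839168,
    -12083734988588195289037900134809075712, 8729021394608951785368849596685484032,
    -2599845890314352459165432379823095808, -1109307876680723940264450857384280064,
    2213563729867888232957922011053555712, -2164913640022299777911764484720951296,
    1533986297041993488592945935990915072, -824982315351018901184740250768900096,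
    402857635647029282799002067979468800, -195627611613185560852287859747454976,
    80607816254129624911259757227016192, -30154772494954044168059737262260224,
    13128300718675665519770056244854784, -5029024897204394930706634837590016, 1574932468040910124719853386334208,
    -719936910953901726077680967745536, 331747797121481296048472077631488, -100700816666840567913428142784512,
    38756825130188670797920312754176, -19142686204827911241169327095808, 5674933296879646438486980952064,
    -1618441090542816437714953437184, 704323768694198769764479795200, -198764660786663232003133931520,
    41976588860622981395770245120, -14922754329447632253220814848, 3604233135374780411875950592,
    -689276588727180127725682688, 148873083879524208029466624, -29770728657117665996832768,
    4479355210345288059322368, -530528782898251677302784, 33571585774474537992192, 18600539749184440369152],
   [4149033412917407327591596032, -19620866052345431505481236480, -532724042745562877496848809984,
    -1659228926756325478959081848832, 217800680124681399429652021248, -8466526407557744579476386217984,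
    -134121228261848150018599143079936, -1385544740072142084935125317976064, 160407417020117801229649497292800,
    -16285869552730040205529668808343552, -40472439264117367293167245243449344,
    16284318167868023164882531379052544, 70377189358504441838974632399470592,
    -104022695348728853285110099403079680, 40915840248017044314173471023169536,
    524475437628302454187907588512808960, -192226866608524783444357503906742272,
    -894753911885836333146464805021810688, 586508772674196958058121475873832960,
    414255413110823430561349334732898304, -1732546869666745523408767547846164480,
    1245718840029397265991740553863102464, 1760971884109800125084266777901268992,
    -1886568346948147381592373216472465408, 709049723290320262714611160894668800,
    -504107489133883185772787661354827776, -3141112630497496282618267842711126016,
    4189287444171066921200742281982771200, 1719455685750886325920973444152819712,
    -5582861175858323796710418403645456384, 6275069350967728877968802479505145856,
    -5344542356032423545915585853273407488, -2290236980773735555343002907187347456,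
    11694495559881660134644136040955117568, -13518688024794886763285905357903233024,
    9006705742563790424801318361976799232, -2508505235885093894989794956315459584,
    -3474428921095695168703332601695305728, 5952716308809125911139054332380446720,
    -4552762917939659178002999323631026176, 2233214498018358724863686145357119488,
    -942624383000010454120030125393182720, 443259737773305218343728334736719872,
    -255819626930693590457860545956544512, 226546525643914914165441229083377664,
    -208800149324729352386601654614491136, 144063187609425604302447693923352576,
    -79419900026256617700800554644537344, 40869404629154847285768411959787520,
    -19101450544160531141839755063328768, 7348484938022373830531159477452800, -2696906219684788813076247871488000,
    1048800305664924846951533010485248, -299937664727779089164375399858176, 59919823474410858960841181495296,
    -23181237134067535776961617985536, 6664285212262841265220774526976, 612548443576167750392503861248,
    -128757507644798584151150166016, -89233575693211390768276570112, -58453260136769206577375739904,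
    13556171181656444302568456192, 1871242466410226899964919808, 1753183881317152030193614848,
    -40550790878436518411632640, -11279741693546787502030848, -9421978771816380874358784,
    1517143333042197765292032, 636526269339980324143104, -265933054396600418304, -3811707113017939329024],
   [7260808472605462823285293056, -44848730056063513123249717248, -1020836909358616516503277666304,
    1071104044938192797587560464384, -5296882940083558369933794476032, 20626621158757173167544114085888,
    -455476731367536890835373993754624, -114676847245279160153187387703296, -2699228587057057244655775217876992,
    -16158269381513145104996622399438848, -17077214354668140906761525942812672,
    40779999429228379611001394751864832, 19281088851903670480664837226496000,
    -74925383282584933058589312673644544, 151652289523754229306999893217247232,
    298163816687471591726019152833413120, -491018504513878523090436586364469248,
    -402821692048668689068063089808637952, 774895644942391065867929583913795584,
    -355964572674143380721003774590582784, -1016453073240790524796231480153997312,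
    1900074633204143461754939044953849856, 213198192312107978612403979600003072,
    -1801641312252853478336542045938647040, 1533134004469647827732246987949473792,
    -1237675968597467612693050904836833280, -2533809488029535960597122277865160704,
    7151245596858616507225433233342595072, -5010598790947475725922654284194775040,
    -783258911827463169693700000669761536, 6106397334037835688373203043323215872,
    -10795833427562311544707568374982377472, 9048242578629783204631148681679077376,
    564999915176688266418528371439828992, -9661979811474473504249399552325451776,
    13020267390994394565298908393317072896, -11232237111469311398694177707745345536,
    5615532514210225250003387917375897600, 630190904760201308681988021860433920,
    -3885934729549096753377225855444451328, 4181606589675046989212941169379508224,
    -3387448714116330566839834404303405056, 2347772142617734669478553186910339072,
    -1359792450667378971476463928196726784, 703275284045236368527007909234606080,
    -360214566399447695825773761770029056, 171989550400104294957276046542503936,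
    -72770873399931572943755393722482688, 32128486339061751556887406335492096,
    -14810901110877515116248651624611840, 5982948886276699489276524360630272, -2553229555046723404521668398284800,
    1255479506807144885829424105127936, -513893976047899399165541512904704, 190258526993996277885097390112768,
    -84783092062849554522993487511552, 32916277292233734980046866612224, -9800860124953851786727067222016,
    3507369366067227318753196769280, -1258577206007058297177403031552, 311697555959905254367706480640,
    -83947576363192611634973507584, 26100292601847744938303815680, -5505204441732407665220386816,
    1201392534288625597421715456, -249528822385515060856356864, 43705717944719082472341504,
    -6870000712311992299290624, 897887755783633970921472, 5427004184167660388352, -23904426778538859823104],
   [5532044550556543103455461376, -34179959697964410656467714048, -838334445315043059716696571904,
    1750093906978745333331053772800, -4727367808985390934591759450112, 23922816114396574647809799618560,
    -406263779367117089432135113113600, 463629101985921879568916217331712, -2665080860551542434295942496649216,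
    -10889354834079238447212813029998592, 3171420779132345392154292485357568, 26960249476690071911348154975387648,
    -23594117769936058757685286499516416, -13366572835924026926479272939880448,
    151326559890794430349033594784055296, -7647019674020260163545344170262528,
    -311787137088730534729948674656305152, 111206092497687109414617532025798656,
    265762469160570343175603014432980992, -516954543317200767459079762533679104,
    88856110410136647842117468133785600, 849987587405504162247085394136924160,
    -627559134967267781281948929775108096, 11369571167185987509318430522081280,
    31477661594630660566155651419471872, -585123014944910239309534428573728768,
    241358555904626624306991422932779008, 1756298880325929351817823686022397952,
    -2234355656872270482722181727198904320, 745857018409774642036481788670377984,
    1120230637961926423726521682550063104, -3611228638035241985079877888351666176,
    4864210664009523484820172576101761024, -2532507061236572458290980326230458368,
    -1508892890148436256213858425287737344, 4282471754538152379905074556676603904,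
    -4942734631817925076989425803767840768, 3599627087336538172519016280981766144,
    -1183777661123652735363520112485203968, -678320920418658455072805178797195264,
    1331173257597147651674094008499437568, -1255613398530466028369030810714505216,
    955722153107198844362355028420198400, -631033097907812126421137279701483520,
    377960277288886189179340408615862272, -221512394452317463102111233662255104,
    127728433005609874555692263409713152, -69346728849330389398280900746149888,
    35612329357823285208897147314896896, -17516022267393962149836206309900288, 8031852527611960676331015376994304,
    -3406897709393500593100980322566144, 1386335397408888535254371288481792, -540868873570691131852909675806720,
    192851066061829726316121942917120, -64385294522772031812940708446208, 21436179195523378349813052473344,
    -6650873116011304384548445356032, 1807850239253649813358719795200, -504557056590102617125872992256,
    141657234879540791361509785600, -29589395286313208371709214720, 6464856892855657829096226816,
    -1858320810574595497727623168, 220075988788373439658328064, -37834848024505837758185472,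
    9699331828968086027894784, -905368171714301581590528, -148498257866399051415552, -256083682011541143552,
    -1270569037672646443008],
   [1555887529844027747846848512, -8704265901225330057884467200, -252366589390557780450144681984,
    504181001913006579024742318080, -838466747134427135697003479040, 6553837191333428710235667693568,
    -115689623282835643431575275700224, 135588499866841423477824913670144, -574377572321204630314666772398080,
    -3720284859986597780681914234961920, 3053652634410990744699342614953984, 10393259719042535106278864820633600,
    -16195233703530951999558235063320576, -5335259211571426363276982780690432,
    66204399822136078819394501428117504, -39818707497518498748689985065451520,
    -126019537024519589325291790826209280, 149839636592181436844078317992673280,
    58543028340386593655079246579630080, -287396332068311818935699672605392896,
    234026886351979258900761388020400128, 231501231522948273172637315139371008,
    -528315174683171507368921098413408256, 351678257288122465357505979532443648,
    6146383178299373222272823440965632, -778391889549550783622903157300920320,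
    1441177590755315628067304816192258048, -735940492188948197732109382146064384,
    -737414069112755242890510537922183168, 1732556020241605259859592404547928064,
    -2030320225440974942626655693260718080, 1114258913731339843115631271401750528,
    901837022843982285466373423240314880, -2298656413882706815450167956918501376,
    2165997802458678887468058446248542208, -1151014672272732824089890380201328640,
    -90124941231647366172564815114928128, 1069023946009420962073950996056244224,
    -1322543718516484084492585225989128192, 974580777263304038380939664278159360,
    -508235069151787661905940819635863552, 136996047365619945166257924819910656,
    122821602591815985843231950114914304, -237475864856997991857435343425896448,
    225873266507001905291326163712475136, -164986117852525915176291033476497408,
    103935594393952354434151007077269504, -56296089754551805982152048498442240,
    26069410343850914346606204341452800, -10794252381967850674775262937219072, 3981492421703888334624098002927616,
    -1159692653721460963995276328042496, 232201786275812405698790120488960, -13416082552860832442271236358144,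
    -28428368479171991583262840455168, 23911169192401984171239681294336, -10871804569499688890589738172416,
    4214805058880520523982785478656, -1738239349491035957694172233728, 580751685903130563427774234624,
    -156647554540008581859446358016, 47901936120072115650505474048, -13353804964496287988082278400,
    2804862943462539456308838400, -656345799571241039780904960, 130220078347602405988761600,
    -21392957728487940777050112, 3330844702350273587183616, -378531809085737681289216, -21269719665535503826944,
    9381527196768959201280],
   [0, 0, -864381961024459859914915840, 5267894258970746628782161920, 136057045211253922180838195200,
    -337588757234198901320528691200, 855184680062422938896721510400, -4711115728066197256153082101760,
    68310581338731084805850487848960, -116682120902585973543318837002240, 492432775126484162979058323292160,
    1618863502446879982370303581880320, -1685326977973409076920322894069760, -2357961218514879873523634216632320,
    6868921037735301990644265988915200, -5337648254410385100493616746332160, -21530894681980636323380207812608000,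
    24585994903206844396552676987371520, 19194626110010157694532678844416000,
    -47650444202991965650685558060482560, 36490530733883906598016050318540800,
    46122867549138375361744674068889600, -106023837948126114403040630428139520,
    29756839356748053581884302263582720, 84906259593175611616949809037967360,
    -223899727296858375620663988379975680, 309215306218683536974003450947829760,
    -75503293395525259355694096334192640, -336409218926142662782245217438269440,
    562660289783279722548184860621537280, -539768560791371466555195036490792960,
    212638652775140432928682752448921600, 356211547642786308146936847815147520,
    -737151972726426293032715967382159360, 686442150232861365843432158076600320,
    -356338651514924851170900851661209600, -54378388595415345225157459396526080,
    373700927852345428562042281661562880, -457857603144038642106035715493068800,
    337798490357760910935329952969523200, -160601199055338776338219219099320320,
    16471444853656645044959344832020480, 69563648935097800577129996353536000,
    -94156871936848016208002152692449280, 77694391380939810588878619258388480,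
    -50033111310225216088356970414735360, 27133111645317335215780268458639360,
    -12156305329666183891690335921766400, 4242387879716688928062771570933760, -1015430457828610283750593145077760,
    -21411472722483597842803515719680, 240738687846756778987135246008320, -189382389509207508163930095616000,
    103397542094662234545582736670720, -49687334823831925556123753512960, 21509545817343940933029745131520,
    -8053663714883537178623737856000, 2809683041910670436458341335040, -964759128738217845440664043520,
    293547055794856347842904064000, -79504139821164857233265131520, 21997960661616427634461245440,
    -5636163359058130660050862080, 1214354465180717026545500160, -255283022522156006747668480,
    48717285086265757893918720, -8057446883719855535554560, 1110403651028789955133440, -89311920038298601390080,
    -8913682008478643650560, 2807071129741893304320]]"

definition certV :: "int list list" where
  "certV = [
   [0, 0, 0, 0, 718101936851089729775468544, -18905181967133571034055180288, 150374051461495071839589761024,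
    -518667257777993776767952748544, 2145932336979435912176450142208, -17742163141014350528486062424064,
    95628079156266570875322784284672, -302902089274895579702746511572992, 184686986520530277208121921241088,
    679879858325164205805311700762624, -4024393364562471266949969481826304, -9554317729870233444092363422040064,
    -1435017501857663350973075071959040, -11645994055901133398057387949031424,
    -28582899983555608779201193290235904, 18992277333852348289259321778241536,
    51326725709730977263566380058279936, 1471376243656704563041070615625728, 33428906730807948942359393650868224,
    59095444839992756904881638082609152, -111099214883988000864360037135417344,
    -44301436992365973518179343693512704, -5384869882109055390900714754539520,
    -121772415206815904144208176290463744, 252123070187523910907997061950472192,
    31800029314462510379716774444662784, -152124567315594713682987839515525120,
    127232636206037319183226746446020608, -288359591537723122841943042133327872,
    85174713944282855314861197872857088, 243655516427780806367852085139996672,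
    -209850273545178086690034012670394368, 155143174097207290569618654322753536,
    -78414548787040627578818432356843520, -95866341362225178074599543585898496,
    144441103021896670789866187856543744, -78979206568696993745744928866041856,
    34755649856362196948656973668155392, -11164875479918615803011345078550528,
    -12331119726410661802567257179553792, 18587567060068382370203300588945408,
    -13500666820723710875720637736812544, 10156667075721160750047240350859264,
    -6981981224770450168775958230728704, 3713663323117735526822932341850112, -1912049250359460844261577022504960,
    975141022975089743456564968161280, -414951433206634883814760864808960, 164362295650060231389438579572736,
    -68930729225235580944566687105024, 25192426385130011387869672767488, -7723710947818275100579969630208,
    2713403499960543112634361184256, -886217701658559017209638682624, 214925662182482189796255989760,
    -62162466119400823862390161408, 18210415097224321208223268864, -2912260550902951972274438144,
    1003392948922235948302860288, -149649163523783890338578432, 23369326833011627837620224,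
    -5073269527896597083455488, 881768345896559925264384, 74148993647284756414464, -4491313807587029286912,
    709154811724267782144],
   [0, 0, 0, 345752784409783943965966336, -24674175978334581455753052160, 335986477176027162178102493184,
    -826453726822780291502271627264, 3905378494098720016803030892544, -28591121776906829148156965421056,
    209365912689531045377038268497920, -449964792273391699314937262243840, 808214062202790430467215463546880,
    3446292964398239081277146020184064, -2973227181761451977559156065304576, -12991875902867520397370352868524032,
    6159006513730997237388689817993216, -8365285861043023830728646848413696, -57280468337371010764017235751075840,
    13740619715922048717229113655427072, 90979813594141459711881844904427520,
    -30289980809760340538093571533701120, 1625226303228237236474702265843712,
    145520781660709138722787295945031680, -144425495985279672835244186954366976,
    -100421916710890627292836192373964800, 71562821137918337455109228631949312,
    -179429674419750726598523537571446784, 293948905590939125109925459433357312,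
    163641535396675841539566978744713216, -379622767460008052029604235262820352,
    154044417539234953912826138978156544, -178565476467976246052146868966653952,
    -117791330081992855440947234885074944, 589655946585248185514611068857483264,
    -394875602814420885012055530126966784, -11089783912629797321816945085906944,
    178339220559894241441104820541849600, -312411877624911185085240621775454208,
    298000376978266585474207216077635584, -78076751724674351920382949069946880,
    -51520557762257322406827810399191040, 37911143919248295128079000529797120,
    -27432158250467863447753472411172864, 30666324248762693454224553339256832,
    -20767854762041746096000201234841600, 14950259006449003962550771091767296,
    -14675149313892781874722277934759936, 10768349602086248444337405703487488,
    -6109302661485110890426897449091072, 3546767764542564823112975135014912, -1872857195800379955699721030336512,
    793713724201849406152484272996352, -341947006383489244302575704997888, 148765005865642022207723518558208,
    -50488878187861601744449395752960, 16255092174117641801095782072320, -6171837285321994506439386726400,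
    1805100381465886164513022017536, -420793594003900006076703047680, 144432650551865139356703391744,
    -34633797113370308932515397632, 4877422161216904861728112640, -2393415118369713151258132480,
    143725949706253599107973120, -38882068595699219179765760, 10930872384039563600855040,
    -741367690764562219401216, -484408184726287080751104, -26121994731456464683008, -4018543933104184098816,
    -354577405862133891072],
   [0, 0, -505330992598914995027181568, -11425557921177860330148069376, 288194012749202027014443237376,
    -130911252460064253098701357056, 2163323339357502160169185837056, -15687312861999819022532767383552,
    154026680703402394182851691020288, 13753181891875760981027909009408, 249719770733423640521537600094208,
    5295880484910176459785371186626560, 5430322435978475773835931562278912, -16691148309841878353012344284512256,
    -10803821512591746358733176915886080, 16888484474327363646019369227517952,
    -63754222812085347988062753335017472, -92257376822194518240577879902519296,
    154868669910134374892022605260259328, 115041923065312062716515880041185280,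
    -140595171351054866646241383706263552, 182195516338120146250329923585572864,
    133133216651015778450457663910182912, -516791581009480467967717271849140224,
    -1316261539138393449404412008071168, 180570615857152964041374165867954176,
    -404857012584083132837900754995904512, 1080208750182192156808275439717974016,
    -173783212535586139517449126451085312, -1079695366492998763509530504604942336,
    1066589355037265069105818481650040832, -1270556187247985565219380088329469952,
    708501586872023433902801765504385024, 1120976821927398158758406684695068672,
    -1728250309551247110846146388317700096, 1100860960936063758171327254428123136,
    -420028623141789631375702255634219008, -462149839801862006450455629306789888,
    1000993129162126084664210466610872320, -714808609825083742396541290470703104,
    235275847503131297779413101934804992, 11283252373916237158846559737085952,
    -127054666108624159690326216856829952, 159235101933449647033513760515948544,
    -113866639821606205330741666248654848, 63746501305958597792020213893431296,
    -36430637646646500877643084361367552, 18221703130848900653038558775345152,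
    -7429028894863142729582017760985088, 3229256359782035439014325749022720, -1361285808549951980998662683623424,
    428761300151318487635564827770880, -143841063724883450292143032107008, 61955234122495067418854797869056,
    -17312384272979687134843214233600, 3727457031059676400554445111296, -2039118228096269333906887540736,
    611210881341799231098527416320, -78317111445501373022109433856, 51743866966599661455966994432,
    -18666482791857977353534701568, 1445814084068337488475717632, -1151095145159217434274562048,
    287182502405450006525902848, -46110439204126753319550976, 11513611838770684920594432,
    -2791607209773383779614720, 367679259883681628553216, -57429866419431546028032, 10243347280461645742080,
    2422945606724581588992],
   [0, -678207384803806967010164736, -165622837287204196934746112, 124382448571235448240700653568,
    465957487579886137436176121856, 95163844879105749802903666688, 155184669529196584983039311872,
    40591343587580197824866400862208, 326716234990698597539606230466560, -8813140825511259953168753098752,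
    3700587841552920440461899329437696, 11367282973961219581032533896200192, -4946865923122126580543168672956416,
    -22303975436924877355235235252404224, 19061055333316057144749612328812544,
    -17833634567326813419346525742432256, -154616458928528528736122274179973120,
    40820838078172178862917034415489024, 228969186306022826153633065444835328,
    -121065301398249199750451466629808128, -10013946033539457619538183941259264,
    433641202606386176254842729811410944, -343187612932541434001865919489376256,
    -413121978147903717558004229383127040, 439738314874578454843223394868002816,
    -554001818967436158616287643944615936, 523308037443336589690508341237776384,
    844797206881749103544315156744896512, -1505778153071772228982494233429540864,
    706162749207791834813557435390754816, -98452653875969535277241407840976896,
    -959267635858797056893100745698574336, 2023549349226285247441602554424721408,
    -1235784176076610259537977518386577408, -391424022860675709450716146995036160,
    1288249925497445116374217769195929600, -1480295696495411525364779563203166208,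
    1068243440394190443012223025167728640, -209746102249648906101471898924744704,
    -370195129493508545688528132065198080, 394932203508857424157077330802507776,
    -258129013278146129994209598810095616, 179619393302492671427450098484772864,
    -117595040334049169271946565262508032, 72160124070806057026389732526915584,
    -54311197545774263789740435445907456, 40537634978863912422930833987338240,
    -24078504899354507944834397871538176, 12918039678750047770021222252806144,
    -6875125795003485491594660635738112, 3129664409174308832631109151883264, -1245195146146719274201089302331392,
    530541291576738401892484067098624, -204480853413365995098682406469632, 60661969545446031016273767301120,
    -20387774717883142450873718800384, 7513139742989892768205773996032, -1702964014651348924047015542784,
    389362730703157658801819090944, -159409590821225890638578319360, 24375917929181079096178769920,
    -2520418035497653470125621248, 2421205012031319439671558144, 124534671514924676605280256,
    22451996082873514432921600, -10645785097089391490236416, -1003682661306924238110720, 714741229824445475979264,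
    109664006509959416119296, 1024334728046164574208, -325029288706956066816],
   [-172876392204891971982983168, -708430530294172696377819136, 23024898928925323604160151552,
    402720693576029210908351791104, -128561176224597139897395970048, 2479344331064729995612692414464,
    -5954227419781627394311533363200, 224436342062294965386162693210112, 33244174233456346557421054853120,
    1538528206625652963401101693943808, 7309045879937073043353621443379200, 8105961933283158502559615098552320,
    -14205427759361472516822674157076480, -3190632373264249313358214483410944,
    21698511128814522090443192433377280, -69682119609598625632067255565025280,
    -112864164353685234791929489074946048, 168549779664671041280502994936266752,
    112489014399639779297404581222285312, -229270934772695681870320726213394432,
    206213293998004471266348261319901184, 250668432096828140970827937350680576,
    -591219368493572281024063948139266048, -41956543604874969798719573476769792,
    484061617829623650865455604443381760, -641546592003388607821369102439546880,
    911126161589932088429626425299959808, 354118494958614861577261868442976256,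
    -2137849170282666398853710713519603712, 2030949795816746776342409434156236800,
    -1107471255795566053824000936044920832, -387494276280964444136976710369280000,
    2741611616975931035588114580441661440, -3426584922170801547732919767802052608,
    1691213905829448672859917440824377344, 366370307520679410262734757441830912,
    -1796825027038813430003066633323544576, 2328867470022662739496110854481379328,
    -1593730086211427279258989569224212480, 400144818305863455737037321108717568,
    279669583467658926930739144157036544, -469249023414576759331353464196300800,
    451660104185636326562013861677891584, -319480675100761476454303538834571264,
    172492278682902987128834232913231872, -85077962123530211712274020763172864,
    41054359347962798378894900475199488, -16282056987814540783670006613278720, 5733790548274844347694576440442880,
    -2375011369258276710380763403517952, 815172058314004699180518787252224, -204354505774448064094611127140352,
    100964030260016089015481884737536, -49073723067914069904170418176000, 12419571208982537574763479433216,
    -5771627068935468310886801735680, 3475997401542512047498440212480, -943021567551580878838433841152,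
    289431652517478694824003502080, -152641322035560468786098208768, 40976945741773316316079325184,
    -8747654744402820476157558784, 3568772438132627457578106880, -841032367442798695539539968,
    170000220130296316492251136, -38025440189599371308826624, 7608714868665308940337152,
    -1229190729908302978744320, 169537976447164930326528, -9795200836941448740864, -5274338912199241629696],
   [-691505568819567887931932672, 2911093373632027052692471808, 94179552588348263911722582016,
    276252545734503623683989307392, -10529895004570871940337631232, 990570318096608386399657263104,
    25554998083801048794857635577856, 217745678174460904658969259147264, 32937978021324666395712448102400,
    2688282481319311483038531370090496, 6934459055029608796374919811170304, -2197713301007074949563843270934528,
    -11497997768429254817264652448169984, 16291067533702648289541063320797184,
    -5601610677588564338761774678409216, -87954903528682973662338927434924032,
    26380447449457291616814696627175424, 149021169585770689089831266301247488,
    -90203043381227189127460613496242176, -71067920435509743207626735471296512,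
    284564811529342188257495246581006336, -189256944638323353415483649547042816,
    -306479120701662759598896478861393920, 309696048210210129886510792648425472,
    -124987326780363633742466811833614336, 84128816881125258782835790732853248,
    551749358444621876310324028293251072, -724470377566880277273809188030513152,
    -247581206903799844325794793461383168, 863646183012134969449218566499860480,
    -1005909846934028838905305981480075264, 898875822917878334573445318810009600,
    323802193472629987456526742854828032, -1812312824950613079871144836726784000,
    2073491091927331882797893388557352960, -1371933447318813270857463287383064576,
    382747002196075002466878761902014464, 535124221095048601661253999210266624,
    -907420264407056196803379963187167232, 684108215887376776290368663987421184,
    -335338760607105401183711687688060928, 146814516674914395552602891327897600,
    -70659675647936598245579188997193728, 39176662632644836028217685673246720,
    -33240255869574308213752743396900864, 29833071611909589744635078105890816,
    -19992926645944568242063273785032704, 10799563462623082607878880800800768,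
    -5533462555628965410160047705554944, 2562060495948315265255116208340992, -966826122980828974653035396464640,
    357003996901216988164196338237440, -141967629742183188806066124095488, 40104233744432038527053821116416,
    -8129281953829883118705210032128, 3553477893823450875781403639808, -1063406436291531107018154704896,
    -50368667548457541310779228160, -11518840086531498361189564416, 23814576152182790582305816576,
    6548945297195875857265065984, -1021269939492847716143202304, -606964189028611216610689024,
    -221907521646995731438895104, -8984603614546563652648960, 5206762651992126469963776, 999208411638325315633152,
    -172221018443169040171008, -108905969627879668973568, -704230125531738144768, 783025104612212342784],
   [-1037258353229351831897899008, 6201789454623047666242682880, 149016427766067843276394725376,
    -153179968288820626154082795520, 749725774019206458870666887168, -3195167820535164778965456912384,
    66619167576557943615423401426944, 10261444790518297407432872165376, 406528852144661115594783036801024,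
    2319742389716144918438483872186368, 2422812501587235141335529958670336, -5575126697387183677644574761680896,
    -2727483679661872675017291703779328, 10093275015092508250865178266042368,
    -21229292567200911609852868616519680, -41767938288363178783274027578294272,
    66501760403407401082797732753571840, 58627413497111026625728076796919808,
    -105316120418705153234332214095773696, 46135986180660163944020325242503168,
    141950498620248699806423598699118592, -258248367123901014179264673695662080,
    -39345707925440684639244912412327936, 244438824982923246373296359451131904,
    -192096072968792894853407333093998592, 147609375950955061797033780224983040,
    387379896354246883647329234487083008, -1022699467522735172919992178597429248,
    686519530901108067245963352010129408, 150569266988647192778137874345230336,
    -906741588958433531953593350705119232, 1562852347365195215090605701594087424,
    -1294785781353470860841519874001862656, -77004404230973678180161421605601280,
    1359634058244999036576829166806106112, -1839233007446079126271171250635145216,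
    1604813279397759724199156511586385920, -824636200637153069257181593568542720,
    -58967903880864335537150244058824704, 533431794277939448873502172109602816,
    -594436612633642103521003759313354752, 493289449935544368904043577816907776,
    -344962716238246538599400229474140160, 198350978640185933996320815444918272,
    -99906773760342485791483485885562880, 48754085337520479298650529954004992,
    -21694613346208631559289176240160768, 8327831534282358373966865500209152, -3408569308249764399103657870622720,
    1526469446319976946250239791071232, -591301556836689390600196966055936, 262099601723433547474481627267072,
    -143950094003924640495340607242240, 62190207779148295573953820229632, -24284410345963129694462039556096,
    11667173863094893761838052278272, -4685016505265969236231866810368, 1429828905144754148299843305472,
    -533361090153513899818972348416, 194092853455907597186125266944, -48445989269250349244274966528,
    13401350463118352792755896320, -4195242650905712632853954560, 887118280250520371996917760,
    -196199893218341645132496896, 41030437821607952385048576, -7212539023592645342527488,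
    1140836752532343846076416, -148504459323085940588544, -1073581589971460947968, 3929899581638650626048],
   [-691505568819567887931932672, 4227613591192358223947497472, 105476359909737166234764443648,
    -218338954345864813069689946112, 585777752339350878828829343744, -3050409909526553192871288111104,
    51033431495342035457936575168512, -58949644763946927496045952761856, 335092271468379991771933516496896,
    1369708601197637520339150462517248, -419814938501135917199705075875840, -3328240266093955577658850137866240,
    2993285340232233638310534226903040, 1448554655203550258149214801362944, -18890836117190674012960559263121408,
    1524637738901653498539707883061248, 38030128452137913638688094395826176, -14270921644056957547247395686842368,
    -30443693011400840520916415018958848, 62909759876093065637035702344482816,
    -14090157178834176153830897685102592, -100577868812797765478343629518929920,
    77314256514638642183197310136090624, -10671485241834791858030066557517824, 9368537099120258632182296618205184,
    68809742126835782703552646822756352, -41022808006901331698506287479259136,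
    -194515503573041334519754037082980352, 251692683448243436721913877986541568,
    -84360972305527265525978474383147008, -119659324902734174691714362607927296,
    411174780296996342637623894196879360, -567899287396693913512315254562881536,
    299094765727423734169493480717418496, 173129919086683519851003967501762560,
    -500487044048407610447689422458585088, 587447060245079033683554432599457792,
    -437484759138570775567761342988288000, 152311178412447957876099228819783680,
    73182873274072550350675982768144384, -157222050733668339060703176366751744,
    153695332134331491727053482084007936, -119961476659124190193043304571994112,
    80207014326467533379092393186295808, -48113707866187013280154468732633088,
    27903259884516494033773672204861440, -15745053821671790963560293387468800, 8330356650200294387937131062362112,
    -4180541955321662739283332294508544, 2015587349838533595798771821707264, -905793050208071531934067600654336,
    377681479502361300239279718400000, -152034941584974130292607443533824, 58659287079097166179752166293504,
    -20652511396508574320738527346688, 6863674699778090595690546724864, -2279874795345765014816163889152,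
    700067086184445299646821040128, -189615336162273403216261545984, 53396331411312844637592354816,
    -14928710352778829673118302208, 3083446326111647421740089344, -684866141491451768281759744,
    200493526564316829152444416, -23190359962758613078900736, 4087777076621408118767616,
    -1088133449950634654564352, 106109112662092651954176, 14935661243017847635968, 206836820086244769792,
    177288702931066945536],
   [-172876392204891971982983168, 967140655691703339764940800, 28040732154506420050016075776,
    -56000164047643756288033161216, 92848751934543734933341339648, -728200018664467001357465812992,
    12856118699159272084018705727488, -15039089973173799484499737706496, 63696091594654419399051373969408,
    413909972598436071961268859174912, -340745423728303124919547305394176, -1156618997137866228543501373538304,
    1806139945171103243446971885682688, 572266517769198924081337429131264, -7365393449519476540994096218505216,
    4486342870282850387058580328022016, 13965876865836628167937491464093696, -16776723124763438063663999044550656,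
    -6174007123953863621043177503326208, 31888121833726279841427973612765184,
    -26599803415143054609395729198743552, -25086195188750867954805226371809280,
    58955631848606146610625600662011904, -40424632607577991114648520161755136, 288934967352538002672940765675520,
    87859555311339536152876850119442432, -163801865707030988036558856520728576,
    85755716090098800407838298103349248, 80595655553207660302658289295949824,
    -196492346712176404792065492514766848, 234195130829182132748463603227557888,
    -132587136815910094910345615547301888, -95967977587461998031820348467445760,
    258238098306567009203989335477583872, -249387604886103143781377909427535872,
    137596173280621091655865689270386688, 4369364342901360928307869911089152,
    -118775486512897766606273434097811456, 150762629236633979121347456632094720,
    -112832899829675888091214403520692224, 59396379063365553902488480932429824,
    -15970193871735296195092490322182144, -14234326835211949108740187779760128,
    27276207072331485264516234566696960, -25742051578136793614185859477667840,
    18621807451873470205524919374053376, -11583266097058786131746072261820416, 6179027041786413784436827358232576,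
    -2806263379104246667921434511147008, 1131255754900204220978454975217664, -400550934145679320055276749455360,
    106671535894461736688450315223040, -15269027286362839135304560934912, -3123086579274514305746617761792,
    5021848101659062525651457146880, -3347982834820609100956498395136, 1449337510613939200704588546048,
    -548259952488685016542540201984, 217676570049659291281706188800, -71569752277052580083676479488,
    19323582331167936687697297408, -5804015006113836509853384704, 1598759689848609123535421440,
    -337300614528720415672500224, 77636453458620637780115456, -15329629977495928383209472,
    2523928465585622382280704, -386798715640930765897728, 42384767705468595339264, 2516514644382644699136,
    -1078506276163990585344],
   [0, 0, 86438196102445985991491584, -526789425897074662878216192, -13605704521125392218083819520,
    33758875723419890132052869120, -85518468006242293889672151040, 471111572806619725615308210176,
    -6831058133873108480585048784896, 11668212090258597354331883700224, -49243277512648416297905832329216,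
    -161886350244687998237030358188032, 168532697797340907692032289406976, 235796121851487987352363421663232,
    -686892103773530199064426598891520, 533764825441038510049361674633216, 2153089468198063632338020781260800,
    -2458599490320684439655267698737152, -1919462611001015769453267884441600, 4765044420299196565068555806048256,
    -3649053073388390659801605031854080, -4612286754913837536174467406888960, 10602383794812611440304063042813952,
    -2975683935674805358188430226358272, -8490625959317561161694980903796736, 22389972729685837562066398837997568,
    -30921530621868353697400345094782976, 7550329339552525935569409633419264, 33640921892614266278224521743826944,
    -56266028978327972254818486062153728, 53976856079137146655519503649079296,
    -21263865277514043292868275244892160, -35621154764278630814693684781514752,
    73715197272642629303271596738215936, -68644215023286136584343215807660032,
    35633865151492485117090085166120960, 5437838859541534522515745939652608, -37370092785234542856204228166156288,
    45785760314403864210603571549306880, -33779849035776091093532995296952320,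
    16060119905533877633821921909932032, -1647144485365664504495934483202048, -6956364893509780057712999635353600,
    9415687193684801620800215269244928, -7769439138093981058887861925838848, 5003311131022521608835697041473536,
    -2713311164531733521578026845863936, 1215630532966618389169033592176640, -424238787971668892806277157093376,
    101543045782861028375059314507776, 2141147272248359784280351571968, -24073868784675677898713524600832,
    18938238950920750816393009561600, -10339754209466223454558273667072, 4968733482383192555612375351296,
    -2150954581734394093302974513152, 805366371488353717862373785600, -280968304191067043645834133504,
    96475912873821784544066404352, -29354705579485634784290406400, 7950413982116485723326513152,
    -2199796066161642763446124544, 563616335905813066005086208, -121435446518071702654550016,
    25528302252215600674766848, -4871728508626575789391872, 805744688371985553555456, -111040365102878995513344,
    8931192003829860139008, 891368200847864365056, -280707112974189330432]]"

section \<open>Coefficientwise check of the elimination identity\<close>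

fun pderivs :: "int \<Rightarrow> int list list \<Rightarrow> int list list" where
  "pderivs n [] = []"
| "pderivs n (l # ls) = psmult n l # pderivs (n + 1) ls"

fun pconv :: "int list list \<Rightarrow> int list list \<Rightarrow> nat \<Rightarrow> int list" where
  "pconv [] ys n = []"
| "pconv (x # xs) ys n = padd (pmult x (if n < length ys then ys ! n else []))
     (if n = 0 then [] else pconv xs ys (n - 1))"

definition cert_coeff :: "nat \<Rightarrow> int list" where
  "cert_coeff n = padd (pconv FK certU n) (pconv (pderivs 1 (tl FK)) certV n)"

definition cert_rhs :: "int list" where
  "cert_rhs = pmult [0, 0, 0, 0, 0, 0, 0, 0, 1, 2, 1] P5_shift"

text \<open>Both products in the combination have degree at most 18 in \<open>c\<close>. Its
  constant coefficient is the right-hand side of the identity; the following lemmas show that the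
  coefficients 1 to 18 vanish, which is what eliminates \<open>c\<close>.\<close>

lemma cert_coeff_0: "list_all (\<lambda>a. a = 0) (padd (cert_coeff 0) (psmult (-1) cert_rhs))"
  by code_simp

lemma cert_coeff_1: "list_all (\<lambda>n. list_all (\<lambda>a. a = 0) (cert_coeff n)) [1, 2, 3, 4]"
  by code_simp

lemma cert_coeff_5: "list_all (\<lambda>n. list_all (\<lambda>a. a = 0) (cert_coeff n)) [5, 6]"
  by code_simp

lemma cert_coeff_7: "list_all (\<lambda>n. list_all (\<lambda>a. a = 0) (cert_coeff n)) [7, 8]"
  by code_simp

lemma cert_coeff_9: "list_all (\<lambda>n. list_all (\<lambda>a. a = 0) (cert_coeff n)) [9, 10]"
  by code_simp

lemma cert_coeff_11: "list_all (\<lambda>n. list_all (\<lambda>a. a = 0) (cert_coeff n)) [11, 12]"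
  by code_simp

lemma cert_coeff_13: "list_all (\<lambda>n. list_all (\<lambda>a. a = 0) (cert_coeff n)) [13, 14]"
  by code_simp

lemma cert_coeff_15: "list_all (\<lambda>n. list_all (\<lambda>a. a = 0) (cert_coeff n)) [15, 16, 17, 18]"
  by code_simp

lemma ev_coeff_Poly: "coeff (Poly (map (\<lambda>l. ev l x) ls)) n = ev (if n < length ls then ls ! n else []) x"
  by (simp add: nth_default_def)

lemma ev_pconv:
  "ev (pconv xs ys n) x = coeff (Poly (map (\<lambda>l. ev l x) xs) * Poly (map (\<lambda>l. ev l x) ys)) n"
  by (induction xs ys n rule: pconv.induct)
    (auto simp: ev_coeff_Poly coeff_pCons nth_default_def split: nat.splits)

text \<open>Entry \<open>i\<close> carries the weight \<open>n + i\<close>, which yields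
  \<open>n p + X p'\<close>. For \<open>n = 1\<close> and the tail of a coefficient list this is the
  product rule for \<open>pCons\<close>, hence the derivative of the whole polynomial.\<close>

lemma Poly_pderivs: "Poly (map (\<lambda>l. ev l x) (pderivs n ls)) 
    = smult (of_int n) (Poly (map (\<lambda>l. ev l x) ls)) + pCons 0 (pderiv (Poly (map (\<lambda>l. ev l x) ls)))"
  by (induction n ls rule: pderivs.induct) (auto simp: pderiv_pCons algebra_simps smult_add_left)

lemma ev_pconv_beyond: "length xs + length ys \<le> Suc n \<Longrightarrow> ev (pconv xs ys n) x = 0"
  by (induction xs ys n rule: pconv.induct) auto

lemma length_pderivs [simp]: "length (pderivs n ls) = length ls"
  by (induction n ls rule: pderivs.induct) auto

lemma pderiv_curve: "pderiv (curve x) = Poly (map (\<lambda>l. ev l x) (pderivs 1 (tl FK)))"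
  by (subst Poly_pderivs) (simp add: curve_def FK_def pderiv_pCons)

lemma cert_coeff_eq_0:
  assumes "0 < n" "n < 19"
  shows "list_all (\<lambda>a. a = 0) (cert_coeff n)"
proof -
  have "n \<in> set [1, 2, 3, 4] \<union> set [5, 6] \<union> set [7, 8] \<union> set [9, 10] \<union> set [11, 12] \<union> set [13, 14]
      \<union> set [15, 16, 17, 18]"
    using assms by simp presburger
  then show ?thesis
    using cert_coeff_1 cert_coeff_5 cert_coeff_7 cert_coeff_9 cert_coeff_11 cert_coeff_13 cert_coeff_15
    by (auto simp only: list_all_iff Un_iff)
qed

text \<open>At a common root of the curve polynomial and its derivative the combination
  \<open>Q\<close> vanishes. But \<open>Q\<close> is constant in \<open>c\<close>, so the right-hand
  side of the identity is zero, and \<open>x > 0\<close> keeps the factor in front of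
  \<open>P5\<close> away from zero.\<close>

lemma P5_of_double_root:
  assumes "poly (curve x) c = 0" "poly (pderiv (curve x)) c = 0" "0 < x"
  shows "poly P5 (4 + 2 * x) = 0"
proof -
  define Q where "Q = curve x * Poly (map (\<lambda>l. ev l x) certU)
     + pderiv (curve x) * Poly (map (\<lambda>l. ev l x) certV)"
  have Q: "coeff Q n = ev (cert_coeff n) x" for n
    by (simp add: Q_def cert_coeff_def pderiv_curve ev_pconv) (simp add: curve_def)
  have 0: "ev (cert_coeff 0) x = ev cert_rhs x"
    using ev_all_0[OF cert_coeff_0, of x] by simp
  have pos: "ev (cert_coeff n) x = 0" if "0 < n" for n
  proof (cases "n < 19")
    case True
    with that show ?thesis by (intro ev_all_0 cert_coeff_eq_0)
  next
    case False
    \<comment> \<open>Both pairs of factors have total length 20, namely 11 + 9 and 10 + 10, the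
      derivative being one entry shorter than \<open>FK\<close>. Hence nothing is left from index 19
      on.\<close>
    have "length FK = 11" "length certU = 9" "length certV = 10"
      by (simp_all add: FK_def certU_def certV_def)
    with False show ?thesis
      unfolding cert_coeff_def ev_padd by (simp add: ev_pconv_beyond)
  qed
  have "Q = [:ev cert_rhs x:]"
    by (rule poly_eqI) (simp add: Q 0 pos coeff_pCons split: nat.split)
  then have "ev cert_rhs x = poly Q c" by simp
  also have "\<dots> = 0" using assms by (simp add: Q_def)
  finally have "ev [0, 0, 0, 0, 0, 0, 0, 0, 1, 2, 1] x * ev P5_shift x = 0"
    by (simp only: cert_rhs_def ev_pmult)
  moreover have "ev [0, 0, 0, 0, 0, 0, 0, 0, 1, 2, 1] x = x ^ 8 * (1 + x) ^ 2"
    by (simp only: ev.simps of_int_0 of_int_1 of_int_numeral) algebra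
  ultimately have "x ^ 8 * (1 + x) ^ 2 * ev P5_shift x = 0"
    by (simp only:)
  then show ?thesis using assms by (simp add: poly_P5_shift)
qed

section \<open>The curve of the reduced equations\<close>

definition curve_at :: "int \<Rightarrow> int \<Rightarrow> int list" where
  "curve_at n d = map (phom n d) FK"

lemma poly_Poly_map_ev:
  "poly (Poly (map (\<lambda>l. of_int (f l) / a) ls)) (c::real) = ev (map f ls) c / a"
  by (induction ls) (auto simp: add_divide_distrib)

lemma ev_curve_at:
  assumes "0 < d"
  shows "ev (curve_at n d) c = of_int d ^ 7 * poly (curve (of_int n / of_int d)) c"
proof -
  have "ev l (of_int n / of_int d) = of_int (phom n d l) / of_int d ^ 7" if "l \<in> set FK" for l
  proof -
    \<comment> \<open>All rows are padded to eight entries, so the single power \<open>d ^ 7\<close>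
      clears every denominator.\<close>
    have "length l = 8" using that by (auto simp: FK_def)
    then have "of_int d * real_of_int (phom n d l) = of_int d * (of_int d ^ 7 * ev l (of_int n / of_int d))"
      using of_int_phom[of d n l] assms by (simp add: numeral_eq_Suc)
    then show ?thesis using assms by (simp add: field_simps)
  qed
  then have "curve (of_int n / of_int d) = Poly (map (\<lambda>l. of_int (phom n d l) / of_int d ^ 7) FK)"
    unfolding curve_def by (intro arg_cong[of _ _ Poly] map_cong) auto
  then show ?thesis using assms by (simp add: poly_Poly_map_ev curve_at_def)
qed

text \<open>Write \<open>x\<close>, \<open>y\<close> for the entries 21 and 41 of a matrix in
  \<open>S5\<close>. Then \<open>v\<close> is \<open>c (c - x)\<close> and \<open>t\<close> is
  \<open>c (1 + x)\<close>, so \<open>t + v = N\<close>. For \<open>N\<close> nonzero,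
  \<open>M / N\<close> is the multiplier of row 4 in the second elimination step and
  \<open>Z / N\<close> is \<open>y c\<close>. The expression is what remains of
  \<open>A^(3)_43 = A^(3)_33\<close> after all substitutions, with denominators cleared.\<close>

definition curveF :: "real \<Rightarrow> real \<Rightarrow> real" where
  "curveF c k = (let N = c * (1 + c); W = 2 - N; v = - (k * W); t = N + k * W;
     M = (1 - 2 * k) * N - 4 * k ^ 2 * W; Z = N * (- 1 - 2 * k - t) + M * (1 + t - c)
     in M * c ^ 3 * t * N - Z * (M * ((2 * k - 1) * t - v ^ 2) + N * t * (1 + c - v)))"

section \<open>Bivariate integer polynomials, outer lists in \<open>c\<close> and inner lists in
  \<open>k\<close>\<close>

fun ev2 :: "int list list \<Rightarrow> real \<Rightarrow> real \<Rightarrow> real" where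
  "ev2 [] c k = 0"
| "ev2 (l # ls) c k = ev l k + c * ev2 ls c k"

fun badd :: "int list list \<Rightarrow> int list list \<Rightarrow> int list list" where
  "badd [] ys = ys"
| "badd (x # xs) [] = x # xs"
| "badd (x # xs) (y # ys) = padd x y # badd xs ys"

fun bmult :: "int list list \<Rightarrow> int list list \<Rightarrow> int list list" where
  "bmult [] ys = []"
| "bmult (x # xs) ys = badd (map (pmult x) ys) ([] # bmult xs ys)"

fun bpow :: "int list list \<Rightarrow> nat \<Rightarrow> int list list" where
  "bpow xs 0 = [[1]]"
| "bpow xs (Suc n) = bmult xs (bpow xs n)"

definition bzero :: "int list list \<Rightarrow> bool" where
  "bzero = list_all (list_all (\<lambda>a. a = 0))"

lemma ev2_badd [simp]: "ev2 (badd xs ys) c k = ev2 xs c k + ev2 ys c k"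
  by (induction xs ys rule: badd.induct) (auto simp: algebra_simps)

lemma ev2_map_pmult [simp]: "ev2 (map (pmult x) ys) c k = ev x k * ev2 ys c k"
  by (induction ys) (auto simp: algebra_simps)

lemma ev2_bmult [simp]: "ev2 (bmult xs ys) c k = ev2 xs c k * ev2 ys c k"
  by (induction xs) (auto simp: algebra_simps)

lemma ev2_bpow [simp]: "ev2 (bpow xs n) c k = ev2 xs c k ^ n"
  by (induction n) auto

lemma ev2_bzero: "bzero ls \<Longrightarrow> ev2 ls c k = 0"
  by (induction ls) (auto simp: bzero_def ev_all_0)

lemma ev2_const: "ev2 (map (\<lambda>a. [a]) l) c k = ev l c"
  by (induction l) auto

lemma ev2_eq_poly: "ev2 ls c k = poly (Poly (map (\<lambda>l. ev l k) ls)) c"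
  by (induction ls) auto

definition bN :: "int list list" where "bN = [[], [1], [1]]"
definition bW :: "int list list" where "bW = [[2], [-1], [-1]]"
definition bkW :: "int list list" where "bkW = [[0, 2], [0, -1], [0, -1]]"
definition bt :: "int list list" where "bt = [[0, 2], [1, -1], [1, -1]]"
definition bM :: "int list list" where "bM = badd (bmult [[1, -2]] bN) (bmult [[0, 0, -4]] bW)"
definition bZ :: "int list list" where
  "bZ = badd (bmult bN (badd [[-1, -2]] (bmult [[-1]] bt))) (bmult bM (badd [[1], [-1]] bt))"
definition bQ :: "int list list" where
  "bQ = badd (bmult bM (badd (bmult [[-1, 2]] bt) (bmult [[-1]] (bpow bkW 2))))
     (bmult (bmult bN bt) (badd [[1], [1]] bkW))"
definition bF :: "int list list" where
  "bF = badd (bmult (bmult bM [[], [], [], [1]]) (bmult bt bN)) (bmult [[-1]] (bmult bZ bQ))"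

lemma curveF_eq_ev2: "curveF c k = ev2 bF c k"
proof -
  define N W where "N = c * (1 + c)" and "W = 2 - N"
  have "ev2 bN c k = N" "ev2 bW c k = W" "ev2 bkW c k = k * W" "ev2 bt c k = N + k * W"
    by (simp_all add: bN_def bW_def bkW_def bt_def N_def W_def algebra_simps)
  then show ?thesis
    unfolding curveF_def Let_def N_def [symmetric] W_def [symmetric]
    by (simp add: bF_def bQ_def bZ_def bM_def power2_eq_square power3_eq_cube algebra_simps)
qed

text \<open>This ties the closed formula to the table \<open>FK\<close> under
  \<open>K = 2 k\<close>. Testing that a difference has only zero coefficients tolerates trailing
  zeros, which equality of lists would not.\<close>

lemma bF_eq_FK: "bzero (badd (bmult [[8]] bF) (bmult [[-1]] (map (plin 0 2) FK)))"
  by code_simp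

lemma poly_curve: "poly (curve (2 * k)) c = 8 * curveF c k"
proof -
  have "poly (curve (2 * k)) c = ev2 (map (plin 0 2) FK) c k"
    by (simp add: ev2_eq_poly curve_def o_def)
  then show ?thesis using ev2_bzero[OF bF_eq_FK, of c k] by (simp add: curveF_eq_ev2 del: bmult.simps)
qed

text \<open>In the homogeneous coordinates \<open>(- k W, t)\<close>, whose sum is \<open>N\<close>, the coefficients of \<open>F\<close> become the
  polynomials \<open>eta ! i\<close> in \<open>c\<close>. Their sign pattern (plus at 0, minus from 2 on) makes positivity of \<open>F\<close> persist as \<open>k\<close> grows.\<close>

definition eta :: "int list list" where
  "eta = [[8, -12, -6, 11, 3, -3, -1, 0],
   [8, -28, -6, 39, 7, -15, -5, 0],
   [-8, 36, 2, 17, -21, -27, -1, 2],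
   [-24, 148, -30, -33, 19, 5, 7, 4],
   [-40, 188, -74, -143, -3, -5, -15, -4],
   [-40, 140, -58, -139, 41, 63, 21, 4],
   [-24, 76, -18, -85, 21, 19, -15, -6],
   [-8, 28, -2, -51, -3, 27, 9, 0]]"

fun bhom :: "int list list \<Rightarrow> int list list" where
  "bhom [] = []"
| "bhom (e # es) = badd (bmult (bpow bt (length es)) (map (\<lambda>a. [a]) e)) (bmult (bmult [[-1]] bkW) (bhom es))"

lemma ev2_bhom:
  "ev2 (bhom es) c k = (\<Sum>i<length es. ev2 bt c k ^ (length es - Suc i) * (- ev2 bkW c k) ^ i * ev (es ! i) c)"
proof (induction es)
  case (Cons e es)
  show ?case
    by (simp add: Cons.IH ev2_const sum.lessThan_Suc_shift sum_distrib_left sum_negf algebra_simps del: sum.lessThan_Suc)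
qed simp

text \<open>Put \<open>v = - k W\<close>. Substituting \<open>k = - v / W\<close> and
  \<open>1 = (t + v) / N\<close> makes \<open>F\<close> homogeneous of degree 7 in
  \<open>(v, t)\<close>. After cancellation of common factors, \<open>W^3 N^4\<close> remains on one
  side and \<open>c^2 (1 + c)\<close> on the other.\<close>

lemma bF_eq_eta:
  "bzero (badd (bmult (map (plin 0 2) FK) (bmult (bpow bW 3) (bpow bN 4)))
     (bmult [[], [], [-8], [-8]] (bhom eta)))"
  by code_simp

lemma curveF_eta:
  fixes c k :: real
  defines "N \<equiv> c * (1 + c)" defines "W \<equiv> 2 - N" defines "t \<equiv> N + k * W"
  shows "curveF c k * W ^ 3 * N ^ 4 = c ^ 2 * (1 + c) * (\<Sum>i<8. (- (k * W)) ^ i * t ^ (7 - i) * ev (eta ! i) c)"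
proof -
  have e: "ev2 bN c k = N" "ev2 bW c k = W" "ev2 bkW c k = k * W" "ev2 bt c k = t"
    by (simp_all add: bN_def bW_def bkW_def bt_def N_def W_def t_def algebra_simps)
  have "ev2 (map (plin 0 2) FK) c k = 8 * curveF c k"
    using poly_curve[of k c] by (simp add: ev2_eq_poly curve_def o_def)
  then have "8 * curveF c k * (W ^ 3 * N ^ 4) = 8 * (c ^ 2 * (1 + c)) * ev2 (bhom eta) c k"
    using ev2_bzero[OF bF_eq_eta, of c k] by (simp add: e power2_eq_square algebra_simps)
  moreover have "length eta = 8" by (simp add: eta_def)
  ultimately show ?thesis by (simp add: ev2_bhom e mult.assoc mult.commute mult.left_commute)
qed

lemma eta_signs: "pos_on (-1) 1 1 (eta ! 0) \<and> list_all (\<lambda>i. pos_on (-1) 1 1 (psmult (-1) (eta ! i))) [2, 3, 4, 5, 6, 7]"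
  by code_simp

lemma eta_0_pos: "-1 < c \<Longrightarrow> c < 0 \<Longrightarrow> 0 < ev (eta ! 0) c"
  using eta_signs ev_pos_on[of "-1" 1 1 "eta ! 0" "c + 1"] by simp

lemma eta_neg:
  assumes "-1 < c" "c < 0" "2 \<le> i" "i < 8"
  shows "ev (eta ! i) c < 0"
proof -
  have "i \<in> set [2, 3, 4, 5, 6, 7]" using assms by simp presburger
  then have "pos_on (-1) 1 1 (psmult (-1) (eta ! i))" using eta_signs unfolding list_all_iff by blast
  from ev_pos_on[OF this, of "c + 1"] assms show ?thesis by simp
qed

text \<open>In this region \<open>- k W\<close> and \<open>t\<close> are both negative. By
  \<open>curveF_eta\<close> and \<open>t ^ 7 < 0\<close>, the value of \<open>F\<close> is positive
  exactly when \<open>E\<close> is negative at the ratio \<open>l\<close> of these two quantities,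
  and \<open>l\<close> grows with \<open>k\<close>. It remains to see that \<open>E\<close>, once
  negative, stays negative.\<close>

lemma curveF_pos_mono:
  assumes c: "-1 < c" "c < 0" and k: "0 < k" "k \<le> k'" and t': "c * (1 + c) + k' * (2 - c * (1 + c)) < 0"
    and pos: "0 < curveF c k"
  shows "0 < curveF c k'"
proof -
  define N W where "N = c * (1 + c)" and "W = 2 - N"
  define E where "E l = (\<Sum>i<8. l ^ i * ev (eta ! i) c)" for l :: real
  have N: "N < 0" using c by (simp add: N_def mult_neg_pos)
  then have W: "0 < W" by (simp add: W_def)
  have sign: "0 < X \<longleftrightarrow> y < 0" if "X * a = b * (u * y)" "0 < a" "0 < b" "u < 0" for X a b u y :: real
  proof -
    have "0 < X \<longleftrightarrow> 0 < X * a" using that(2) by (simp add: zero_less_mult_iff)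
    also have "\<dots> \<longleftrightarrow> y < 0" unfolding that(1) using that(3,4) by (simp add: zero_less_mult_iff)
    finally show ?thesis .
  qed
  have sgn: "0 < curveF c x \<longleftrightarrow> E (x * W / - (N + x * W)) < 0" if "N + x * W < 0" for x
  proof -
    define t where "t = N + x * W"
    have "(- (x * W)) ^ i * t ^ (7 - i) = t ^ 7 * (x * W / - t) ^ i" if "i < 8" for i
    proof -
      have "t ^ 7 = t ^ (7 - i) * t ^ i" using that by (simp add: power_add [symmetric])
      moreover have "(- (x * W)) ^ i = t ^ i * (x * W / - t) ^ i"
      proof -
        have "t \<noteq> 0" using \<open>N + x * W < 0\<close> by (simp add: t_def)
        then have "- (x * W) = t * (x * W / - t)" by simp
        then show ?thesis by (metis power_mult_distrib)
      qed
      ultimately show ?thesis by simp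
    qed
    then have "curveF c x * (W ^ 3 * N ^ 4) = c ^ 2 * (1 + c) * (t ^ 7 * E (x * W / - t))"
      using curveF_eta[of c x] unfolding E_def sum_distrib_left
      by (simp add: N_def W_def t_def mult.assoc)
    moreover have "0 < W ^ 3 * N ^ 4" "0 < c ^ 2 * (1 + c)" "t ^ 7 < 0"
      using W N c that by (auto simp: t_def intro!: mult_pos_pos zero_less_power2[THEN iffD2])
    ultimately show ?thesis
      unfolding t_def [symmetric] by (rule sign)
  qed
  define l l' where "l = k * W / - (N + k * W)" and "l' = k' * W / - (N + k' * W)"
  have t: "N + k * W \<le> N + k' * W" "N + k' * W < 0"
    using k W t' by (auto simp: N_def W_def intro: mult_right_mono)
  have tk: "N + k * W < 0" using t by linarith
  have l: "0 < l"
    unfolding l_def using tk k W by (intro divide_pos_pos mult_pos_pos) linarith+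
  have ll': "l \<le> l'"
    unfolding l_def l'_def
  proof (rule frac_le)
    show "k * W \<le> k' * W" using k W by (simp add: mult_right_mono)
    show "0 \<le> k' * W" using k W by simp
    show "0 < - (N + k' * W)" "- (N + k' * W) \<le> - (N + k * W)" using t by linarith+
  qed
  have "E l < 0" using sgn[of k, OF tk] pos by (simp add: l_def)
  \<comment> \<open>Multiplied out, this says that \<open>E l / l\<close> does not increase. There
    \<open>eta ! 0\<close>, which is positive, has weight \<open>1 / l\<close>,
    \<open>eta ! 1\<close> has constant weight, and the negative entries from 2 on have weight
    \<open>l ^ (i - 1)\<close>.\<close>
  have "l * E l' \<le> l' * E l"
  proof -
    have "l * (l' ^ i * ev (eta ! i) c) \<le> l' * (l ^ i * ev (eta ! i) c)" if "i < 8" for i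
    proof -
      consider "i = 0" | "i = 1" | "2 \<le> i" by linarith
      then show ?thesis
      proof cases
        case 1
        have "l * ev (eta ! 0) c \<le> l' * ev (eta ! 0) c"
          using ll' eta_0_pos[OF c] by (intro mult_right_mono) auto
        then show ?thesis using 1 by simp
      next
        case 2
        then show ?thesis by simp
      next
        case 3
        then obtain j where j: "i = Suc j" by (cases i) auto
        have "(l * l') * l ^ j \<le> (l * l') * l' ^ j"
          using l ll' by (intro mult_left_mono power_mono) auto
        then have "l' * l ^ i \<le> l * l' ^ i" by (simp add: j mult_ac)
        from mult_right_mono_neg[OF this, of "ev (eta ! i) c"] eta_neg[OF c 3 that]
        show ?thesis by (simp add: mult_ac)
      qed
    qed
    then show ?thesis unfolding E_def sum_distrib_left by (intro sum_mono) simp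
  qed
  also have "l' * E l < 0" using \<open>E l < 0\<close> l ll' by (intro mult_pos_neg) auto
  finally have "E l' < 0" using l by (simp add: mult_less_0_iff)
  then show ?thesis using sgn[of k'] t by (simp add: l'_def)
qed

section \<open>Exact integer slices of the curve just below and just above the optimum\<close>

lemma curve_at_K_lo: "curve_at 17786141 268435456 =
    [4376237787817692170527840901552762389957999689386164224,
    184870025988897273550774773707294097303115399413496003248,
    4288518171075346317207748308386303736129564296003334194512,
    54266124147230526779205550590510537844465364608224795209032,
    419800998833980821386721697284087416693728082249347385226592,
    1747514908192440544490801307771589548932473809103979031596643,
    3934121714053420218438677527651386826419268144905343503864399,
    4802919002323530514781482947972452772486196676986421323030350,
    2990659815183842706000924737557510244158175555034771243824982,
    742393026505848312620704820358714252558706497237836788935255,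
    -1589010753968924332850962506836395731796418683785000043605]"
  by code_simp

lemma curve_at_K_hi: "curve_at 17786142 268435456 =
    [4376239033345654220256672762303951572766641989418483712,
    184870067456550460950651160354765232363460553694921656320,
    4288518898367968925610863522166144451197105333648698603520,
    54266130507831016649762749873165846614286384430812672207872,
    419801027945042380859805300198517972847548862465894285119488,
    1747514963162129660940559355817387357866983811358149581397120,
    3934121752839990773919419209675470838432590972205665629167232,
    4802919000121427023511101049899210169272954779106147142878464,
    2990659802078107688872239798353588802693658259817700223291648,
    742393022685305535814111223372709744760801231310301367872128,
    -1589010922893863490829046224220261746078829999543064885120]"
  by code_simp

text \<open>The four intervals cover (-1, 0) outside the open window from -1857/4096 to -29/64; the
  last two are traversed from right to left, so that 0 is the excluded end. The negative value is
  taken at -3713/8192, the midpoint of the window.\<close>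

lemma pos_on_K_lo:
  "pos_on (-4) 1 4 (curve_at 17786141 268435456)"
  "pos_on (-3072) 1215 4096 (curve_at 17786141 268435456)"
  "pos_on (-12) (-17) 64 (curve_at 17786141 268435456)"
  "pos_on 0 (-3) 16 (curve_at 17786141 268435456)"
  "phom (-3713) 8192 (curve_at 17786141 268435456) < 0"
  unfolding curve_at_K_lo by code_simp+

text \<open>The left end -929/2048 lies slightly to the left of the window, so the closed window
  stays clear of the excluded end.\<close>

lemma pos_on_K_hi: "pos_on (-929) 1 2048 (curve_at 17786142 268435456)"
  unfolding curve_at_K_hi by code_simp

text \<open>Consecutive multiples of \<open>2 ^ -28\<close> that enclose the optimal \<open>K = 0.0662585393\<dots>\<close>\<close>

abbreviation "K_lo \<equiv> 17786141 / 268435456 :: real"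
abbreviation "K_hi \<equiv> 17786142 / 268435456 :: real"

lemma curve_K_lo_pos:
  assumes "-1 < c" "c < 0" "c \<le> -1857/4096 \<or> -29/64 \<le> c"
  shows "0 < poly (curve K_lo) c"
proof -
  have *: "0 < poly (curve K_lo) c"
    if "pos_on a b d (curve_at 17786141 268435456)" "0 < x" "x \<le> 1" "c = (of_int a + of_int b * x) / of_int d"
    for a b d x
    using ev_pos_on[OF that(1-3)] that(4) by (simp add: ev_curve_at zero_less_mult_iff)
  consider "c \<le> -3/4" | "-3/4 < c" "c \<le> -1857/4096" | "-29/64 \<le> c" "c < -3/16" | "-3/16 \<le> c"
    using assms by linarith
  then show ?thesis
  proof cases
    case 1
    with assms pos_on_K_lo show ?thesis by (intro *[of "-4" 1 4 "4 * c + 4"]) auto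
  next
    case 2
    with pos_on_K_lo show ?thesis
      by (intro *[of "-3072" 1215 4096 "(4096 * c + 3072) / 1215"]) (auto simp: field_simps)
  next
    case 3
    with pos_on_K_lo show ?thesis
      by (intro *[of "-12" "-17" 64 "(64 * c + 12) / - 17"]) (auto simp: field_simps)
  next
    case 4
    with assms pos_on_K_lo show ?thesis by (intro *[of 0 "-3" 16 "- 16 * c / 3"]) auto
  qed
qed

lemma curve_K_hi_pos:
  assumes "-1857/4096 \<le> c" "c \<le> -29/64"
  shows "0 < poly (curve K_hi) c"
proof -
  define x where "x = 2048 * c + 929"
  have x: "c = (of_int (- 929) + of_int 1 * x) / of_int 2048" by (simp add: x_def field_simps)
  have "0 < x" "x \<le> 1" using assms by (auto simp: x_def)
  then have "0 < ev (curve_at 17786142 268435456) c"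
    unfolding x using pos_on_K_hi by (intro ev_pos_on) auto
  then show ?thesis by (simp add: ev_curve_at zero_less_mult_iff)
qed

text \<open>Together with positivity at \<open>K_hi\<close> this forces the curve to pass between
  \<open>K_lo\<close> and \<open>K_hi\<close>, so the set over which \<open>K\<close> is maximized
  is nonempty.\<close>

lemma curve_K_lo_neg: "poly (curve K_lo) (- 3713 / 8192) < 0"
proof -
  have "real_of_int 8192 * of_int (phom (-3713) 8192 (curve_at 17786141 268435456)) < 0"
    using pos_on_K_lo by simp
  then show ?thesis
    by (subst (asm) of_int_phom) (auto simp: ev_curve_at mult_less_0_iff)
qed

section \<open>The largest \<open>K\<close> on the curve\<close>

lemma poly_curve_half: "poly (curve x) c = 8 * curveF c (x / 2)"
  using poly_curve[of "x / 2" c] by simp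

lemma continuous_curve: "continuous_on A (\<lambda>z. poly (curve (snd z)) (fst z))"
  unfolding poly_curve_half curveF_def Let_def by (auto intro!: continuous_intros)

lemma curve_pos_mono:
  assumes "-1 < c" "c < 0" "0 < K" "K \<le> K'" "c * (1 + c) + K' / 2 * (2 - c * (1 + c)) < 0"
    "0 < poly (curve K) c"
  shows "0 < poly (curve K') c"
  using curveF_pos_mono[of c "K / 2" "K' / 2"] assms by (simp add: poly_curve_half)

lemma optimum_exists:
  obtains c K where "-1857/4096 < c" "c < -29/64" "K_lo \<le> K" "K \<le> K_hi"
    "poly (curve K) c = 0" "poly (pderiv (curve K)) c = 0"
    "\<And>c' K'. -1 < c' \<Longrightarrow> c' < 0 \<Longrightarrow> 0 < K' \<Longrightarrow> c' * (1 + c') + K' / 2 * (2 - c' * (1 + c')) < 0 \<Longrightarrow>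
       poly (curve K') c' = 0 \<Longrightarrow> K' \<le> K"
proof -
  define a b where "a = (- 1857 / 4096 :: real)" and "b = (- 29 / 64 :: real)"
  define S where "S = {z \<in> {a..b} \<times> {K_lo..K_hi}. poly (curve (snd z)) (fst z) = 0}"
  have ivt: "\<exists>y. x \<le> y \<and> y \<le> K_hi \<and> poly (curve y) c = 0"
    if "poly (curve x) c \<le> 0" "x \<le> K_hi" "a \<le> c" "c \<le> b" for x c
  proof (rule IVT')
    show "poly (curve x) c \<le> 0" "0 \<le> poly (curve K_hi) c" "x \<le> K_hi"
      using that curve_K_hi_pos[of c] by (auto simp: a_def b_def)
    have "continuous_on {x..K_hi} ((\<lambda>z. poly (curve (snd z)) (fst z)) \<circ> (\<lambda>y. (c, y)))"
      by (rule continuous_on_compose) (auto intro!: continuous_intros continuous_curve)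
    then show "continuous_on {x..K_hi} (\<lambda>y. poly (curve y) c)" by (simp add: o_def)
  qed
  have tneg: "c * (1 + c) + x / 2 * (2 - c * (1 + c)) < 0" if "a \<le> c" "c \<le> b" "0 \<le> x" "x \<le> K_hi" for c x
  proof -
    \<comment> \<open>This bounds \<open>c^2\<close> by its chord over the window, so that the
      estimate of \<open>N\<close> becomes linear in \<open>c\<close>.\<close>
    have "(c - a) * (b - c) \<ge> 0" using that by simp
    then have N: "c * (1 + c) \<le> - 1 / 5" by (simp add: a_def b_def algebra_simps) (use that in \<open>simp add: a_def b_def\<close>)
    have "x / 2 * (2 - c * (1 + c)) \<le> K_hi / 2 * (2 - c * (1 + c))"
      using that N by (intro mult_right_mono) auto
    with N show ?thesis by simp
  qed
  have "compact S"
  proof -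
    have "S = ({a..b} \<times> {K_lo..K_hi}) \<inter> (\<lambda>z. poly (curve (snd z)) (fst z)) -` {0}"
      by (auto simp: S_def)
    moreover have "closed \<dots>"
      by (intro continuous_closed_preimage continuous_curve) (auto intro: closed_Times)
    ultimately have "closed S" by simp
    then have "compact (({a..b} \<times> {K_lo..K_hi}) \<inter> S)"
      by (intro compact_Int_closed compact_Times compact_Icc)
    moreover have "({a..b} \<times> {K_lo..K_hi}) \<inter> S = S" by (auto simp: S_def)
    ultimately show ?thesis by simp
  qed
  obtain y0 where y0: "K_lo \<le> y0" "y0 \<le> K_hi" "poly (curve y0) (- 3713 / 8192) = 0"
    using ivt[of K_lo "- 3713 / 8192"] curve_K_lo_neg by (auto simp: a_def b_def)
  then have "(- 3713 / 8192, y0) \<in> S" by (simp add: S_def a_def b_def)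
  then have "S \<noteq> {}" by blast
  obtain z where z: "z \<in> S" "\<And>y. y \<in> S \<Longrightarrow> snd y \<le> snd z"
    using continuous_attains_sup[OF \<open>compact S\<close> \<open>S \<noteq> {}\<close> continuous_on_snd[OF continuous_on_id]]
    by blast
  define c K where "c = fst z" and "K = snd z"
  have cK: "a \<le> c" "c \<le> b" "K_lo \<le> K" "K \<le> K_hi" "poly (curve K) c = 0"
    using z(1) by (auto simp: S_def c_def K_def)
  have max: "y \<le> K" if "poly (curve y) x = 0" "a \<le> x" "x \<le> b" "K_lo \<le> y" "y \<le> K_hi" for x y
    using z(2)[of "(x, y)"] that by (auto simp: S_def K_def)
  \<comment> \<open>Over either end of the window the slice is positive at \<open>K_lo\<close> and
    remains so up to \<open>K_hi\<close>. The maximum is therefore attained at an interior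
    \<open>c\<close>, as the derivative test requires.\<close>
  have ends: "c \<noteq> e" if "e = a \<or> e = b" for e
  proof
    assume "c = e"
    then have "0 < poly (curve K_lo) c" using that by (intro curve_K_lo_pos) (auto simp: a_def b_def)
    then have "0 < poly (curve K) c"
      using cK tneg[of c K] curve_pos_mono[of c K_lo K] by (auto simp: a_def b_def)
    with cK show False by simp
  qed
  have ab: "a < c" "c < b" using cK ends[of a] ends[of b] by auto
  \<comment> \<open>A negative value at height \<open>K\<close> would produce a zero strictly above
    it, against the choice of \<open>K\<close>. Hence \<open>c\<close>, with value 0, minimizes this
    slice over the window.\<close>
  have nonneg: "0 \<le> poly (curve K) x" if x: "a \<le> x" "x \<le> b" for x
  proof (rule ccontr)
    assume neg: "\<not> ?thesis"
    then obtain y where y: "K \<le> y" "y \<le> K_hi" "poly (curve y) x = 0"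
      using ivt[of K x] cK x by auto
    then have "y \<le> K" using max[of y x] cK x by auto
    with y neg show False by auto
  qed
  have "poly (pderiv (curve K)) c = 0"
  proof (rule DERIV_local_min[OF poly_DERIV])
    show "0 < min (c - a) (b - c)" using ab by simp
    show "\<forall>y. \<bar>c - y\<bar> < min (c - a) (b - c) \<longrightarrow> poly (curve K) c \<le> poly (curve K) y"
      using nonneg cK by (auto simp: abs_if split: if_splits)
  qed
  moreover have "K' \<le> K" if h: "-1 < c'" "c' < 0" "0 < K'" "c' * (1 + c') + K' / 2 * (2 - c' * (1 + c')) < 0"
       "poly (curve K') c' = 0" for c' K'
  proof (rule ccontr)
    assume "\<not> K' \<le> K"
    then have "K_lo \<le> K'" using cK by simp
    \<comment> \<open>A point higher than the maximum cannot lie beside the window, where positivity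
      starts at \<open>K_lo\<close>, nor above \<open>K_hi\<close>, where positivity starts at
      \<open>K_hi\<close>. So it lies in the box, whose maximum is \<open>K\<close>.\<close>
    have "a < c'" "c' < b"
      using curve_pos_mono[of c' K_lo K'] curve_K_lo_pos[of c'] h \<open>K_lo \<le> K'\<close>
      by (auto simp: a_def b_def intro!: leI less_le_not_le[THEN iffD2] dest: less_imp_le)
    moreover from this have "K' \<le> K_hi"
      using curve_pos_mono[of c' K_hi K'] curve_K_hi_pos[of c'] h
      by (intro leI notI) (auto simp: a_def b_def)
    ultimately have "K' \<le> K" using max[of K' c'] h \<open>K_lo \<le> K'\<close> by simp
    with \<open>\<not> K' \<le> K\<close> show False ..
  qed
  ultimately show thesis
    using that[of c K] ab cK unfolding a_def b_def by blast
qed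

section \<open>Schur complements and LU factors\<close>

declare One_nat_def [simp del]

text \<open>Associativity on the leading block: \<open>B = B (A B') = (B A) B' = B'\<close>.\<close>

lemma is_lead_inv_unique:
  assumes "is_lead_inv A m B" "is_lead_inv A m B'" "p \<in> {1..m}" "q \<in> {1..m}"
  shows "B p q = B' p q"
proof -
  have "B p q = (\<Sum>r=1..m. if r = q then B p r else 0)"
    using assms(4) by simp
  also have "\<dots> = (\<Sum>r=1..m. B p r * (\<Sum>t=1..m. A r t * B' t q))"
    using assms by (intro sum.cong) (auto simp: is_lead_inv_def)
  also have "\<dots> = (\<Sum>t=1..m. (\<Sum>r=1..m. B p r * A r t) * B' t q)"
    by (simp add: sum_distrib_left sum_distrib_right mult.assoc) (rule sum.swap)
  also have "\<dots> = (\<Sum>t=1..m. (if p = t then 1 else 0) * B' t q)"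
    using assms by (intro sum.cong) (auto simp: is_lead_inv_def)
  also have "\<dots> = (\<Sum>t=1..m. if p = t then B' t q else 0)"
    by (rule sum.cong) auto
  also have "\<dots> = B' p q" using assms(3) by simp
  finally show ?thesis .
qed

lemma is_lead_inv_lead_inv:
  assumes "lead_invertible A m"
  shows "is_lead_inv A m (lead_inv A m)"
proof -
  from assms obtain B where B: "is_lead_inv A m B" by (auto simp: lead_invertible_def)
  \<comment> \<open>\<open>lead_inv\<close> is described as the inverse that vanishes outside the
    block, so the given inverse is first cut off there.\<close>
  define B' where "B' p q = (if p \<in> {1..m} \<and> q \<in> {1..m} then B p q else 0)" for p q
  have "(\<Sum>r=1..m. A p r * B' r q) = (\<Sum>r=1..m. A p r * B r q)"
    "(\<Sum>r=1..m. B' p r * A r q) = (\<Sum>r=1..m. B p r * A r q)"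
    if "p \<in> {1..m}" "q \<in> {1..m}" for p q
    using that by (auto simp: B'_def intro!: sum.cong)
  with B have B': "is_lead_inv A m B'"
    by (simp add: is_lead_inv_def)
  have "lead_inv A m = B'"
    unfolding lead_inv_def
  proof (rule the_equality)
    show "is_lead_inv A m B' \<and> (\<forall>p q. p \<notin> {1..m} \<or> q \<notin> {1..m} \<longrightarrow> B' p q = 0)"
      using B' by (auto simp: B'_def)
  next
    fix X assume X: "is_lead_inv A m X \<and> (\<forall>p q. p \<notin> {1..m} \<or> q \<notin> {1..m} \<longrightarrow> X p q = 0)"
    show "X = B'"
    proof (intro ext)
      fix p q
      show "X p q = B' p q"
        using X B' is_lead_inv_unique[of A m X B' p q]
        by (cases "p \<in> {1..m} \<and> q \<in> {1..m}") (auto simp: B'_def)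
    qed
  qed
  with B' show ?thesis by simp
qed

lemma lead_inv_right:
  "lead_invertible A m \<Longrightarrow> p \<in> {1..m} \<Longrightarrow> q \<in> {1..m} \<Longrightarrow>
    (\<Sum>r=1..m. A p r * lead_inv A m r q) = (if p = q then 1 else 0)"
  using is_lead_inv_lead_inv[of A m] by (simp add: is_lead_inv_def)

lemma lead_inv_left:
  "lead_invertible A m \<Longrightarrow> p \<in> {1..m} \<Longrightarrow> q \<in> {1..m} \<Longrightarrow>
    (\<Sum>r=1..m. lead_inv A m p r * A r q) = (if p = q then 1 else 0)"
  using is_lead_inv_lead_inv[of A m] by (simp add: is_lead_inv_def)

lemma row_combination_unique:
  assumes "lead_invertible A m" "\<And>l. l \<in> {1..m} \<Longrightarrow> f l = (\<Sum>q=1..m. w q * A q l)" "q \<in> {1..m}"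
  shows "(\<Sum>p=1..m. f p * lead_inv A m p q) = w q"
proof -
  have "(\<Sum>p=1..m. f p * lead_inv A m p q)
      = (\<Sum>p=1..m. (\<Sum>r=1..m. w r * A r p) * lead_inv A m p q)"
    using assms(2) by (intro sum.cong) auto
  also have "\<dots> = (\<Sum>r=1..m. w r * (\<Sum>p=1..m. A r p * lead_inv A m p q))"
    by (simp add: sum_distrib_left sum_distrib_right mult.assoc) (rule sum.swap)
  also have "\<dots> = (\<Sum>r=1..m. if r = q then w r else 0)"
    using assms by (intro sum.cong) (auto simp: lead_inv_right)
  also have "\<dots> = w q" using assms(3) by simp
  finally show ?thesis .
qed

text \<open>The weights are determined by the leading columns: they are row \<open>i\<close> times
  the inverse. From here on a Schur complement is computed by exhibiting weights.\<close>

lemma schur_eq_row_combination: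
  assumes "lead_invertible A m" "\<And>l. l \<in> {1..m} \<Longrightarrow> A i l = (\<Sum>q=1..m. w q * A q l)"
  shows "schur A (Suc m) i j = A i j - (\<Sum>q=1..m. w q * A q j)"
proof -
  have "(\<Sum>p=1..m. \<Sum>q=1..m. A i p * lead_inv A m p q * A q j)
      = (\<Sum>q=1..m. (\<Sum>p=1..m. A i p * lead_inv A m p q) * A q j)"
    by (simp add: sum_distrib_right) (rule sum.swap)
  also have "\<dots> = (\<Sum>q=1..m. w q * A q j)"
    using row_combination_unique[OF assms(1), of "A i" w] assms(2) by (intro sum.cong) auto
  finally show ?thesis by (simp add: schur_def)
qed

lemma row_combination_exists:
  assumes "lead_invertible A m"
  obtains w where "\<And>l. l \<in> {1..m} \<Longrightarrow> f l = (\<Sum>q=1..m. w q * A q l)"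
proof
  fix l assume l: "l \<in> {1..m}"
  have "(\<Sum>q=1..m. (\<Sum>p=1..m. f p * lead_inv A m p q) * A q l)
      = (\<Sum>p=1..m. f p * (\<Sum>q=1..m. lead_inv A m p q * A q l))"
    by (simp add: sum_distrib_left sum_distrib_right mult.assoc) (rule sum.swap)
  also have "\<dots> = (\<Sum>p=1..m. if p = l then f p else 0)"
    using assms l by (intro sum.cong) (auto simp: lead_inv_left)
  also have "\<dots> = f l" using l by simp
  finally show "f l = (\<Sum>q=1..m. (\<Sum>p=1..m. f p * lead_inv A m p q) * A q l)" ..
qed

lemma schur_1 [simp]: "schur A 1 i j = A i j"
  by (simp add: schur_def)

lemma lead_invertible_0 [simp]: "lead_invertible A 0"
  by (simp add: lead_invertible_def is_lead_inv_def)

text \<open>\<open>schur\<close> has values also at indices below \<open>k\<close>. These zeros, and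
  those of \<open>schur_eq_0_row\<close>, are what makes the factors triangular later.\<close>

lemma schur_eq_0:
  assumes "lead_invertible A m" "l \<in> {1..m}"
  shows "schur A (Suc m) i l = 0"
proof -
  obtain w where w: "\<And>l. l \<in> {1..m} \<Longrightarrow> A i l = (\<Sum>q=1..m. w q * A q l)"
    using row_combination_exists[OF assms(1)] by blast
  show ?thesis using schur_eq_row_combination[of A m i w l, OF assms(1) w] w[OF assms(2)] by simp
qed

text \<open>A zero pivot would make row \<open>Suc m\<close> a combination of the rows above it on
  the first \<open>Suc m\<close> columns. Then \<open>w'\<close>, with last weight -1, would
  represent the zero row, although weights are unique when the larger block is invertible.\<close>

lemma pivot_nonzero:
  assumes "lead_invertible A m" "lead_invertible A (Suc m)"
  shows "schur A (Suc m) (Suc m) (Suc m) \<noteq> 0"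
proof
  assume 0: "schur A (Suc m) (Suc m) (Suc m) = 0"
  obtain w where w: "\<And>l. l \<in> {1..m} \<Longrightarrow> A (Suc m) l = (\<Sum>q=1..m. w q * A q l)"
    using row_combination_exists[OF assms(1)] by blast
  define w' where "w' q = (if q = Suc m then -1 else w q)" for q
  have "A (Suc m) (Suc m) = (\<Sum>q=1..m. w q * A q (Suc m))"
    using schur_eq_row_combination[of A m "Suc m" w "Suc m", OF assms(1) w] 0 by simp
  with w have "0 = (\<Sum>q=1..Suc m. w' q * A q l)" if "l \<in> {1..Suc m}" for l
    using that by (cases "l = Suc m") (auto simp: w'_def)
  from row_combination_unique[OF assms(2), of "\<lambda>_. 0" w', OF this, of "Suc m"]
  show False by (simp add: w'_def)
qed

text \<open>The quotient property of Schur complements. If \<open>w\<close> represents row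
  \<open>i\<close> and \<open>v\<close> represents row \<open>Suc m\<close> on the first
  \<open>m\<close> columns, then \<open>w - \<mu> v\<close>, with the additional weight
  \<open>\<mu>\<close> on row \<open>Suc m\<close>, represents row \<open>i\<close> on one column
  more, provided that \<open>\<mu>\<close> is the elimination multiplier.\<close>

lemma schur_Suc:
  assumes "lead_invertible A m" "lead_invertible A (Suc m)"
  shows "schur A (Suc (Suc m)) i j = schur A (Suc m) i j
    - schur A (Suc m) i (Suc m) * schur A (Suc m) (Suc m) j / schur A (Suc m) (Suc m) (Suc m)"
proof -
  define P where "P = schur A (Suc m) (Suc m) (Suc m)"
  define \<mu> where "\<mu> = schur A (Suc m) i (Suc m) / P"
  have P: "P \<noteq> 0" using pivot_nonzero[OF assms] by (simp add: P_def)
  obtain w where w: "\<And>l. l \<in> {1..m} \<Longrightarrow> A i l = (\<Sum>q=1..m. w q * A q l)"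
    using row_combination_exists[OF assms(1)] by blast
  obtain v where v: "\<And>l. l \<in> {1..m} \<Longrightarrow> A (Suc m) l = (\<Sum>q=1..m. v q * A q l)"
    using row_combination_exists[OF assms(1)] by blast
  note sw = schur_eq_row_combination[of A m i w, OF assms(1) w]
  note sv = schur_eq_row_combination[of A m "Suc m" v, OF assms(1) v]
  define u where "u q = (if q = Suc m then \<mu> else w q - \<mu> * v q)" for q
  have u: "(\<Sum>q=1..Suc m. u q * A q l)
      = (\<Sum>q=1..m. w q * A q l) + \<mu> * (A (Suc m) l - (\<Sum>q=1..m. v q * A q l))" for l
    by (simp add: u_def sum_subtractf sum_distrib_left algebra_simps)
  have "A i l = (\<Sum>q=1..Suc m. u q * A q l)" if "l \<in> {1..Suc m}" for l
  proof (cases "l = Suc m")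
    case True
    then show ?thesis unfolding u using sw[of "Suc m"] sv[of "Suc m"] P by (simp add: \<mu>_def P_def)
  next
    case False
    with that have "l \<in> {1..m}" by auto
    from w[OF this] v[OF this] show ?thesis unfolding u by simp
  qed
  from schur_eq_row_combination[of A "Suc m" i u j, OF assms(2) this]
  show ?thesis unfolding u using sw[of j] sv[of j] P by (simp add: \<mu>_def P_def)
qed

text \<open>The converse of \<open>pivot_nonzero\<close>; it puts the extremal matrix, known only
  through its pivots, into \<open>S5\<close>.\<close>

lemma lead_invertible_Suc:
  assumes inv: "lead_invertible A m" and P0: "schur A (Suc m) (Suc m) (Suc m) \<noteq> 0"
  shows "lead_invertible A (Suc m)"
proof -
  define P where "P = schur A (Suc m) (Suc m) (Suc m)"
  define n where "n = Suc m"
  define B where "B = lead_inv A m"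
  define w where "w q = (\<Sum>p=1..m. A n p * B p q)" for q
  define u where "u p = (\<Sum>q=1..m. B p q * A q n)" for p
  \<comment> \<open>The block inverse of a bordered matrix: \<open>P\<close> is the Schur complement
    of the corner, \<open>w\<close> the new row times \<open>B\<close>, and \<open>u\<close> is
    \<open>B\<close> times the new column.\<close>
  define X where "X p q = (if p = n then (if q = n then 1 / P else - w q / P)
     else (if q = n then - u p / P else B p q + u p * w q / P))" for p q
  have P: "P \<noteq> 0" using P0 by (simp add: P_def)
  have BR: "(\<Sum>r=1..m. A p r * B r q) = (if p = q then 1 else 0)" if "p \<in> {1..m}" "q \<in> {1..m}" for p q
    using lead_inv_right[OF inv that] by (simp add: B_def)
  have BL: "(\<Sum>r=1..m. B p r * A r q) = (if p = q then 1 else 0)" if "p \<in> {1..m}" "q \<in> {1..m}" for p q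
    using lead_inv_left[OF inv that] by (simp add: B_def)
  have Au: "(\<Sum>r=1..m. A p r * u r) = A p n" if "p \<in> {1..m}" for p
  proof -
    have "(\<Sum>r=1..m. A p r * u r) = (\<Sum>q=1..m. (\<Sum>r=1..m. A p r * B r q) * A q n)"
      by (simp add: u_def sum_distrib_left sum_distrib_right mult.assoc) (rule sum.swap)
    also have "\<dots> = (\<Sum>q=1..m. if p = q then A q n else 0)"
      using that by (intro sum.cong) (auto simp: BR)
    finally show ?thesis using that by simp
  qed
  have wA: "(\<Sum>r=1..m. w r * A r q) = A n q" if "q \<in> {1..m}" for q
  proof -
    have "(\<Sum>r=1..m. w r * A r q) = (\<Sum>p=1..m. A n p * (\<Sum>r=1..m. B p r * A r q))"
      by (simp add: w_def sum_distrib_left sum_distrib_right mult.assoc) (rule sum.swap)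
    also have "\<dots> = (\<Sum>p=1..m. if p = q then A n p else 0)"
      using that by (intro sum.cong) (auto simp: BL)
    finally show ?thesis using that by simp
  qed
  have sP: "(\<Sum>r=1..m. w r * A r n) = A n n - P"
    using schur_eq_row_combination[of A m n w n, OF inv] wA by (simp add: P_def n_def)
  have uP: "(\<Sum>r=1..m. A n r * u r) = A n n - P"
  proof -
    have "(\<Sum>r=1..m. A n r * u r) = (\<Sum>r=1..m. w r * A r n)"
      by (simp add: u_def w_def sum_distrib_left sum_distrib_right mult.assoc) (rule sum.swap)
    then show ?thesis using sP by simp
  qed
  have wn: "(\<Sum>r=1..m. A n r * B r q) = w q" and un: "(\<Sum>r=1..m. B q r * A r n) = u q" for q
    by (simp_all add: w_def u_def)
  have nm: "p = n \<or> p \<in> {1..m}" if "p \<in> {1..n}" for p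
    using that by (auto simp: n_def)
  have ne: "p \<noteq> n" if "p \<in> {1..m}" for p
    using that by (auto simp: n_def)
  have split: "(\<Sum>r=1..n. f r) = (\<Sum>r=1..m. f r) + f n" for f :: "nat \<Rightarrow> real"
    by (simp add: n_def)
  have right: "(\<Sum>r=1..n. A p r * X r q) = (if p = q then 1 else 0)"
    if p: "p \<in> {1..n}" and q: "q \<in> {1..n}" for p q
  proof (cases "q = n")
    case True
    have "(\<Sum>r=1..m. A p r * X r q) = - (\<Sum>r=1..m. A p r * u r) / P"
      unfolding sum_negf [symmetric] sum_divide_distrib
      using ne by (intro sum.cong) (auto simp: X_def True)
    moreover have "X n q = 1 / P" using True by (simp add: X_def)
    ultimately show ?thesis
      unfolding split using nm[OF p] Au[of p] uP P ne[of p] True by (auto simp: diff_divide_distrib)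
  next
    case False
    have "(\<Sum>r=1..m. A p r * X r q) = (\<Sum>r=1..m. A p r * B r q) + (\<Sum>r=1..m. A p r * u r) * w q / P"
      unfolding sum_divide_distrib sum_distrib_right sum.distrib [symmetric]
      using False ne by (intro sum.cong) (auto simp: X_def algebra_simps)
    moreover have "q \<in> {1..m}" using nm[OF q] False by simp
    moreover have "X n q = - w q / P" using False by (simp add: X_def)
    ultimately show ?thesis
      unfolding split using nm[OF p] Au[of p] uP P BR[of p q] False wn[of q] ne[of p]
      by (auto simp: left_diff_distrib diff_divide_distrib)
  qed
  have left: "(\<Sum>r=1..n. X p r * A r q) = (if p = q then 1 else 0)"
    if p: "p \<in> {1..n}" and q: "q \<in> {1..n}" for p q
  proof (cases "p = n")
    case True
    have "(\<Sum>r=1..m. X p r * A r q) = - (\<Sum>r=1..m. w r * A r q) / P"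
      unfolding sum_negf [symmetric] sum_divide_distrib
      using ne by (intro sum.cong) (auto simp: X_def True)
    moreover have "X p n = 1 / P" using True by (simp add: X_def)
    ultimately show ?thesis
      unfolding split using nm[OF q] wA[of q] sP P ne[of q] True by (auto simp: diff_divide_distrib)
  next
    case False
    have "(\<Sum>r=1..m. X p r * A r q) = (\<Sum>r=1..m. B p r * A r q) + u p * (\<Sum>r=1..m. w r * A r q) / P"
      unfolding sum_divide_distrib sum_distrib_left sum.distrib [symmetric]
      using False ne by (intro sum.cong) (auto simp: X_def algebra_simps)
    moreover have "p \<in> {1..m}" using nm[OF p] False by simp
    moreover have "X p n = - u p / P" using False by (simp add: X_def)
    ultimately show ?thesis
      unfolding split using nm[OF q] wA[of q] sP P BL[of p q] False un[of p] ne[of q]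
      by (auto simp: right_diff_distrib diff_divide_distrib)
  qed
  show ?thesis
    unfolding lead_invertible_def is_lead_inv_def
    using left right by (intro exI[of _ X]) (auto simp: n_def)
qed

lemma schur_eq_0_row:
  assumes "lead_invertible A m" "i \<in> {1..m}"
  shows "schur A (Suc m) i j = 0"
proof -
  have *: "(\<Sum>q=1..m. (if q = i then 1 else 0) * A q l) = A i l" for l
  proof -
    have "(\<Sum>q=1..m. (if q = i then 1 else 0) * A q l) = (\<Sum>q=1..m. if q = i then A q l else 0)"
      by (rule sum.cong) auto
    then show ?thesis using assms(2) by simp
  qed
  show ?thesis
    using schur_eq_row_combination[of A m i "\<lambda>q. if q = i then 1 else 0" j, OF assms(1)] *
    by simp
qed

section \<open>Uniqueness of LU factors and the growth factor in terms of pivots\<close>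

lemma is_LU_unique:
  assumes LU: "is_LU n A L U" and LU': "is_LU n A L' U'"
    and piv: "\<And>k. 1 \<le> k \<Longrightarrow> k < n \<Longrightarrow> U k k \<noteq> 0"
  shows "L = L' \<and> U = U'"
proof -
  have key: "(\<forall>j\<in>{1..n}. U k j = U' k j) \<and> (\<forall>i\<in>{1..n}. L i k = L' i k)" if "k \<in> {1..n}" for k
    using that
  \<comment> \<open>In the order of elimination: the earlier rows of \<open>U\<close> and columns of
    \<open>L\<close> determine row \<open>k\<close> of \<open>U\<close>, and then column
    \<open>k\<close> of \<open>L\<close> after division by the pivot.\<close>
  proof (induction k rule: less_induct)
    case (less k)
    have split: "A i j = (\<Sum>r=1..<k. L i r * U r j) + L i k * U k j"
      if "is_LU n A L U" "i \<in> {1..n}" "j \<in> {1..n}" "i = k \<or> j = k" for L U i j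
    proof -
      have "(\<Sum>r=1..n. L i r * U r j) = (\<Sum>r=1..k. L i r * U r j)"
        using that less.prems by (intro sum.mono_neutral_right) (auto simp: is_LU_def)
      also have "{1..k} = insert k {1..<k}" using less.prems by auto
      finally show ?thesis using that by (simp add: is_LU_def)
    qed
    have same: "(\<Sum>r=1..<k. L i r * U r j) = (\<Sum>r=1..<k. L' i r * U' r j)"
      if "i \<in> {1..n}" "j \<in> {1..n}" for i j
      using less that by (intro sum.cong) auto
    have Lkk: "L k k = 1" "L' k k = 1" using LU LU' less.prems by (auto simp: is_LU_def)
    have U: "U k j = U' k j" if "j \<in> {1..n}" for j
      using split[OF LU, of k j] split[OF LU', of k j] same[of k j] that less.prems Lkk by simp
    have "L i k = L' i k" if "i \<in> {1..n}" for i
    proof (cases "k < n")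
      case True
      have "L i k * U k k = L' i k * U k k"
        using split[OF LU, of i k] split[OF LU', of i k] same[of i k] that less.prems U[of k] by auto
      then show ?thesis using piv[of k] True less.prems by simp
    next
      case False
      \<comment> \<open>The last column of \<open>L\<close> is fixed by the unit triangular shape,
        without division, so the last pivot may be zero.\<close>
      then have "k = n" using less.prems by simp
      then show ?thesis
        using that LU LU' by (cases "i = n") (auto simp: is_LU_def)
    qed
    with U show ?case by blast
  qed
  have "L i j = L' i j \<and> U i j = U' i j" for i j
    using key[of i] key[of j] LU LU' by (cases "i \<in> {1..n} \<and> j \<in> {1..n}") (auto simp: is_LU_def)
  then show ?thesis by (simp add: fun_eq_iff)
qed

text \<open>The diagonal is set to 1 separately because the last pivot may vanish, and the quotient
  would then be 0.\<close>

definition schur_L :: "nat \<Rightarrow> rmat \<Rightarrow> rmat" where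
  "schur_L n A i k = (if i \<in> {1..n} \<and> k \<in> {1..n}
     then if i = k then 1 else schur A k i k / schur A k k k else 0)"

definition schur_U :: "nat \<Rightarrow> rmat \<Rightarrow> rmat" where
  "schur_U n A k j = (if k \<in> {1..n} \<and> j \<in> {1..n} then schur A k k j else 0)"

context
  fixes A :: rmat and n :: nat
  assumes inv: "\<And>m. m \<in> {1..n - 1} \<Longrightarrow> lead_invertible A m" and n: "2 \<le> n"
begin

lemma inv': "m < n \<Longrightarrow> lead_invertible A m"
  using inv[of m] by (cases "m = 0") auto

lemma pivot_nz: "1 \<le> k \<Longrightarrow> k < n \<Longrightarrow> schur A k k k \<noteq> 0"
  using pivot_nonzero[of A "k - 1"] inv'[of k] inv'[of "k - 1"] by simp

lemma schur_lower: "1 \<le> j \<Longrightarrow> j < k \<Longrightarrow> k \<le> n \<Longrightarrow> schur A k i j = 0"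
  using schur_eq_0[of A "k - 1" j i] inv'[of "k - 1"] by simp

lemma schur_upper: "1 \<le> i \<Longrightarrow> i < k \<Longrightarrow> k \<le> n \<Longrightarrow> schur A k i j = 0"
  using schur_eq_0_row[of A "k - 1" i j] inv'[of "k - 1"] by simp

text \<open>A telescoped \<open>schur_Suc\<close>: each elimination step subtracts one matrix of
  rank at most one.\<close>

lemma schur_expansion:
  "k < n \<Longrightarrow> A i j = (\<Sum>r=1..k. schur A r i r / schur A r r r * schur A r r j) + schur A (Suc k) i j"
proof (induction k)
  case 0
  show ?case using schur_1[of A i j] by (simp add: One_nat_def)
next
  case (Suc k)
  then show ?case using schur_Suc[OF inv'[of k] inv'[of "Suc k"], of i j] by simp
qed

lemma is_LU_schur: "is_LU n A (schur_L n A) (schur_U n A)"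
  unfolding is_LU_def
proof (intro conjI ballI allI impI)
  fix i j assume ij: "i \<in> {1..n}" "j \<in> {1..n}"
  obtain k where k: "n = Suc k" using n by (cases n) auto
  have "A i j = (\<Sum>r=1..k. schur A r i r / schur A r r r * schur A r r j) + schur A n i j"
    using schur_expansion[of k i j] k by simp
  also have "(\<Sum>r=1..k. schur A r i r / schur A r r r * schur A r r j)
      = (\<Sum>r=1..k. schur_L n A i r * schur_U n A r j)"
    using ij pivot_nz k by (intro sum.cong) (auto simp: schur_L_def schur_U_def)
  \<comment> \<open>What remains after \<open>n - 1\<close> steps lives in row \<open>n\<close>
    only, where the factor from \<open>L\<close> is 1; it supplies the last summand of the
    product.\<close>
  also have "schur A n i j = schur_L n A i n * schur_U n A n j"
  proof (cases "i = n")
    case False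
    then show ?thesis using ij schur_upper[of i n j] schur_upper[of i n n]
      by (simp add: schur_L_def schur_U_def)
  qed (use ij in \<open>simp add: schur_L_def schur_U_def\<close>)
  finally show "A i j = (\<Sum>r=1..n. schur_L n A i r * schur_U n A r j)" by (simp add: k)
qed (use schur_lower schur_upper in \<open>auto simp: schur_L_def schur_U_def\<close>)

lemma LU_factors_eq: "LU_factors n A = (schur_L n A, schur_U n A)"
  unfolding LU_factors_def
proof (rule the_equality)
  show "case (schur_L n A, schur_U n A) of (L, U) \<Rightarrow> is_LU n A L U"
    using is_LU_schur by simp
next
  fix x assume "case x of (L, U) \<Rightarrow> is_LU n A L U"
  then have "is_LU n A (fst x) (snd x)" by (simp add: case_prod_unfold)
  from is_LU_unique[OF is_LU_schur this] have "schur_L n A = fst x \<and> schur_U n A = snd x"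
    using pivot_nz by (simp add: schur_U_def)
  then show "x = (schur_L n A, schur_U n A)" by simp
qed

end

lemma max_norm_set_finite: "finite {\<bar>M i j\<bar> | i j. i \<in> {1..n} \<and> j \<in> {1..n::nat}}"
proof -
  have "{\<bar>M i j\<bar> | i j. i \<in> {1..n} \<and> j \<in> {1..n}} = (\<lambda>(i, j). \<bar>M i j\<bar>) ` ({1..n} \<times> {1..n})"
    by (auto simp: image_iff) blast
  then show ?thesis by simp
qed

lemma max_norm_ge: "i \<in> {1..n} \<Longrightarrow> j \<in> {1..n} \<Longrightarrow> \<bar>M i j\<bar> \<le> max_norm n M"
  unfolding max_norm_def by (intro Max_ge max_norm_set_finite) auto

lemma max_norm_le:
  assumes "1 \<le> n" "\<And>i j. i \<in> {1..n} \<Longrightarrow> j \<in> {1..n} \<Longrightarrow> \<bar>M i j\<bar> \<le> R"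
  shows "max_norm n M \<le> R"
proof -
  have "\<bar>M 1 1\<bar> \<in> {\<bar>M i j\<bar> | i j. i \<in> {1..n} \<and> j \<in> {1..n}}" using assms(1) by auto
  then have "{\<bar>M i j\<bar> | i j. i \<in> {1..n} \<and> j \<in> {1..n}} \<noteq> {}" by blast
  then show ?thesis
    unfolding max_norm_def using assms(2) by (subst Max_le_iff[OF max_norm_set_finite]) auto
qed

text \<open>Pivoting in the first step gives \<open>max_norm n A = 1\<close>. In the later steps it
  bounds the entries of \<open>L\<close> by 1 and row \<open>k\<close> of \<open>U\<close> by the
  pivot in it, so only the pivots have to be estimated.\<close>

lemma
  assumes inv: "\<And>m. m \<in> {1..n - 1} \<Longrightarrow> lead_invertible A m" and n: "2 \<le> n"
    and piv: "completely_pivoted n A" and A11: "A 1 1 = 1"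
  shows growth_factor_ge_last_pivot: "\<bar>schur A n n n\<bar> \<le> growth_factor n A"
    and growth_factor_le: "1 \<le> R \<Longrightarrow> (\<And>k. k \<in> {1..n} \<Longrightarrow> \<bar>schur A k k k\<bar> \<le> R) \<Longrightarrow> growth_factor n A \<le> R"
proof -
  have cp: "\<bar>schur A k i j\<bar> \<le> \<bar>schur A k k k\<bar>" if "1 \<le> k" "k < n" "i \<in> {k..n}" "j \<in> {k..n}" for k i j
    using piv that by (auto simp: completely_pivoted_def)
  have "max_norm n A = 1"
  proof (rule antisym)
    show "max_norm n A \<le> 1"
      using cp[of 1] n A11 by (intro max_norm_le) auto
    show "1 \<le> max_norm n A"
      using max_norm_ge[of 1 n 1 A] n A11 by simp
  qed
  then have g: "growth_factor n A = max (max_norm n (schur_L n A)) (max_norm n (schur_U n A))"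
    using LU_factors_eq[of n A, OF inv n] by (simp add: growth_factor_def)
  show "\<bar>schur A n n n\<bar> \<le> growth_factor n A"
    using max_norm_ge[of n n n "schur_U n A"] n g by (simp add: schur_U_def le_max_iff_disj)
  show "growth_factor n A \<le> R" if R: "1 \<le> R" "\<And>k. k \<in> {1..n} \<Longrightarrow> \<bar>schur A k k k\<bar> \<le> R"
  proof -
    have "max_norm n (schur_L n A) \<le> R"
    proof (rule max_norm_le)
      fix i j assume ij: "i \<in> {1..n}" "j \<in> {1..n}"
      consider "i = j" | "i < j" | "j < i" by linarith
      then show "\<bar>schur_L n A i j\<bar> \<le> R"
      proof cases
        case 2
        then show ?thesis using ij R schur_upper[OF inv n, of i j j] by (simp add: schur_L_def)
      next
        case 3
        have "\<bar>schur A j i j / schur A j j j\<bar> \<le> 1"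
          using cp[of j i j] pivot_nz[OF inv n, of j] 3 ij by (simp add: abs_divide divide_le_eq_1)
        then show ?thesis using 3 ij R by (simp add: schur_L_def)
      qed (use ij R in \<open>simp add: schur_L_def\<close>)
    qed (use n in simp)
    moreover have "max_norm n (schur_U n A) \<le> R"
    proof (rule max_norm_le)
      fix i j assume ij: "i \<in> {1..n}" "j \<in> {1..n}"
      show "\<bar>schur_U n A i j\<bar> \<le> R"
      proof (cases "j < i")
        case True
        then show ?thesis using ij R schur_lower[OF inv n, of j i i] by (simp add: schur_U_def)
      next
        case False
        then have "\<bar>schur A i i j\<bar> \<le> \<bar>schur A i i i\<bar>"
          using ij cp[of i i j] by (cases "i = j") auto
        then show ?thesis using ij R(2)[of i] by (simp add: schur_U_def)
      qed
    qed (use n in simp)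
    ultimately show ?thesis by (simp add: g)
  qed
qed

section \<open>From the matrices to the curve and back\<close>

text \<open>Here \<open>b\<close>, \<open>c\<close>, \<open>d\<close> are the entries 13, 14, 15,
  \<open>x\<close> and \<open>y\<close> the entries 21 and 41, \<open>e\<close>, \<open>f\<close>,
  \<open>h\<close> the rest of the pivot row of \<open>A^(2)\<close>, and \<open>p\<close>,
  \<open>q\<close>, \<open>s\<close> the pivots two to four. The multipliers are \<open>m\<close>,
  for row 4 in step two, and \<open>w\<close>, for row 5 in step three. The equations are the
  prescribed equalities written out; complete pivoting enters through the bounds on
  \<open>c\<close>, \<open>x\<close> and \<open>q\<close>.\<close>

lemma curve_of_elimination:
  fixes b c d e f h m p q s w x y :: real
  assumes cb: "-1 \<le> c" "c \<le> 1" and xb: "-1 \<le> x" "x \<le> 1"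
    and p: "p = 1 - c" "p \<noteq> 0" and yb: "y * b = c" and q: "q = 2 + x * c - c\<^sup>2" "\<bar>q\<bar> \<le> 2 * \<bar>p\<bar>"
    and d: "d * (1 + x) = c * (c - x)" and f: "f = - 1 - x * c" and h: "h = 1 - x * d"
    and me: "m * e = p - q" and w: "w * q = 1 + c * b + e" "w * (c * (1 + x)) = s - q"
    and s55: "3 + (c - x) * d + c * b + e = s"
    and s44: "y * c + m * f = 1 - c - x * c - s" and s45: "y * d + m * h = 1 + q - s"
  shows "0 \<le> s"
    and "2 < s \<Longrightarrow> -1 < c \<and> c < 0 \<and> c * (1 + c) + (s - 2) / 2 * (2 - c * (1 + c)) < 0
           \<and> curveF c ((s - 2) / 2) = 0"
proof -
  define N v t k where "N = c * (1 + c)" and "v = c * (c - x)" and "t = c * (1 + x)" and "k = (s - 2) / 2"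
  have s: "s = 2 + 2 * k" by (simp add: k_def field_simps)
  have tv: "t + v = N" by (simp add: N_def v_def t_def algebra_simps)
  have qv: "q = 2 - v" by (simp add: q v_def algebra_simps power2_eq_square)
  have dt: "d * t = c * v" using d unfolding t_def v_def by algebra
  have cxdt: "(c - x) * d * t = v\<^sup>2" using dt unfolding v_def by algebra
  \<comment> \<open>Multiplying the two equations for \<open>w\<close> crosswise removes
    \<open>w\<close>, \<open>b\<close> and \<open>e\<close>. With \<open>q = 2 - v\<close> the terms
    \<open>v^2\<close> cancel, and a relation linear in \<open>s\<close> remains that expresses
    \<open>v\<close> by \<open>c\<close> and \<open>k\<close>.\<close>
  have "(s - 2) * (N - 2) = 2 * v"
  proof -
    have "(s - 2 - (c - x) * d) * t = (s - q) * q"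
      using w s55 unfolding t_def by algebra
    then show ?thesis using cxdt tv qv by algebra
  qed
  then have v: "v = - (k * (2 - N))" by (simp add: s algebra_simps)
  have W: "2 - N = (c + 2) * (1 - c)" by (simp add: N_def algebra_simps)
  have c1: "c < 1" using p cb by auto
  \<comment> \<open>\<open>2 p - q\<close> equals \<open>- c (2 + x - c)\<close>, which would be
    negative for \<open>c > 0\<close>, against the bound on \<open>q\<close>.\<close>
  have c0: "c \<le> 0"
  proof (rule ccontr)
    assume "\<not> c \<le> 0"
    then have "0 < c * (2 + x - c)" using xb c1 by simp
    moreover have "2 + x * c - c\<^sup>2 \<le> 2 * (1 - c)" using q p c1 by simp
    ultimately show False by (simp add: algebra_simps power2_eq_square)
  qed
  have Wpos: "0 < 2 - N" using W c1 cb by simp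
  show "0 \<le> s"
  proof -
    have "c * x \<ge> c" using c0 xb mult_left_mono_neg[of x 1 c] by simp
    then have "v \<le> - c * (1 - c)" by (simp add: v_def algebra_simps)
    moreover have "s * (2 - N) = 2 * (2 - N) - 2 * v" using v by (simp add: s algebra_simps)
    moreover have "0 \<le> (1 + c) * (1 - c)" using cb by simp
    ultimately have "0 \<le> s * (2 - N)" by (simp add: W algebra_simps)
    then show ?thesis using Wpos by (simp add: zero_le_mult_iff)
  qed
  show "-1 < c \<and> c < 0 \<and> c * (1 + c) + (s - 2) / 2 * (2 - c * (1 + c)) < 0
           \<and> curveF c ((s - 2) / 2) = 0" if "2 < s"
  proof -
    have "0 < k" using that by (simp add: k_def)
    then have vneg: "v < 0" using Wpos v by simp
    then have "c \<noteq> 0" by (auto simp: v_def)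
    with c0 have c: "c < 0" by simp
    with vneg have xc: "x < c" by (simp add: v_def mult_less_0_iff)
    with xb have cm1: "-1 < c" by simp
    have "x \<noteq> -1" using vneg d by (auto simp: v_def)
    with xb c have tneg: "t < 0" by (simp add: t_def mult_neg_pos)
    have tk: "t = N + k * (2 - N)" using tv v by simp
    define M where "M = (1 - 2 * k) * N - 4 * k ^ 2 * (2 - N)"
    define Z where "Z = N * (- 1 - 2 * k - t) + M * (1 + t - c)"
    define Y where "Y = y * c"
    have f': "f = - 1 - t + c" by (simp add: f t_def algebra_simps)
    have xt: "x * c = t - c" by (simp add: t_def algebra_simps)
    have ht: "h * t = t - (t - c) * v" using dt xt unfolding h by algebra
    \<comment> \<open>Two linear equations for \<open>Y = y c\<close> and \<open>m\<close>. The
      second is \<open>s45\<close> times \<open>t\<close>, which removes the denominator of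
      \<open>d\<close>; subtracting \<open>v\<close> times the first leaves the coefficient
      \<open>t + v = N\<close> at \<open>m\<close>.\<close>
    have 1: "Y + m * f = 1 - t - s" using s44 xt by (simp add: Y_def)
    have 2: "Y * v + m * (t - (t - c) * v) = (3 - v - s) * t"
    proof -
      have "Y * v = y * (d * t)" using dt by (simp add: Y_def)
      moreover have "m * (t - (t - c) * v) = m * (h * t)" using ht by simp
      ultimately have "Y * v + m * (t - (t - c) * v) = (y * d + m * h) * t" by (simp only: distrib_right mult.assoc)
      also have "\<dots> = (3 - v - s) * t" unfolding s45 qv by simp
      finally show ?thesis .
    qed
    have "m * (t + v) = t * (3 - v - s) - v * (1 - t - s)"
      using 1 2 unfolding f' by algebra
    then have mN: "m * N = M"
      using tv tk unfolding M_def s v by (simp add: algebra_simps power2_eq_square)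
    have YN: "Y * N = Z"
      using 1 mN unfolding Z_def f' s by algebra
    have eY: "e * Y * t = ((s - 3) * t - v\<^sup>2) * Y - c ^ 3 * t"
    proof -
      have e: "e = s - 3 - (c - x) * d - c * b" using s55 by simp
      have "e * Y * t = (s - 3) * t * Y - ((c - x) * d * t) * Y - c * t * (y * b) * c"
        unfolding Y_def e by (simp add: algebra_simps)
      then show ?thesis unfolding cxdt yb by (simp add: algebra_simps power3_eq_cube)
    qed
    \<comment> \<open>The equation \<open>m e = p - q\<close> is the only one left. The factor
      \<open>Y t\<close> eliminates \<open>e\<close>, and a further \<open>N^2\<close> turns
      \<open>m\<close> and \<open>Y\<close> into \<open>M\<close> and \<open>Z\<close>.\<close>
    have "m * (((s - 3) * t - v\<^sup>2) * Y - c ^ 3 * t) = Y * t * (p - q)"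
    proof -
      have "m * (e * Y * t) = (m * e) * (Y * t)" by simp
      then show ?thesis unfolding eY me by (simp add: mult_ac)
    qed
    then have "M * (((s - 3) * t - v\<^sup>2) * Z - c ^ 3 * t * N) = Z * N * t * (p - q)"
      unfolding mN [symmetric] YN [symmetric] by algebra
    then have "M * c ^ 3 * t * N - Z * (M * ((2 * k - 1) * t - v ^ 2) + N * t * (1 + c - v)) = 0"
      unfolding s p qv by algebra
    then have "curveF c k = 0"
      unfolding curveF_def Let_def N_def [symmetric] v [symmetric] tk [symmetric]
        M_def [symmetric] Z_def [symmetric] .
    with c cm1 tneg tk show ?thesis by (simp add: k_def N_def)
  qed
qed

lemma schur_step:
  assumes "1 \<le> k" "lead_invertible A (k - 1)" "lead_invertible A k"
  shows "schur A (Suc k) i j = schur A k i j - schur A k i k * schur A k k j / schur A k k k"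
  using schur_Suc[of A "k - 1" i j] assms by simp

text \<open>In the last step the entry \<open>s\<close> loses \<open>(- s) s / s\<close>, which
  doubles it. The third pivot is a difference of two entries of \<open>A^(2)\<close>, both bounded
  by \<open>p = 1 - c\<close>, hence by 2 in absolute value.\<close>

lemma S5_properties:
  assumes "A \<in> S5"
  defines "s \<equiv> schur A 4 4 4" and "c \<equiv> A 1 4"
  shows "schur A 5 5 5 = 2 * s" "\<bar>schur A 2 2 2\<bar> \<le> 2" "\<bar>schur A 3 3 3\<bar> \<le> 4" "0 \<le> s"
    and "2 < s \<Longrightarrow> -1 < c \<and> c < 0 \<and> c * (1 + c) + (s - 2) / 2 * (2 - c * (1 + c)) < 0
           \<and> curveF c ((s - 2) / 2) = 0"
proof -
  have A: "A 1 1 = 1" "A 1 2 = 1" "A 2 4 = -1" "A 2 5 = 1" "A 3 1 = -1" "A 3 4 = -1" "A 3 5 = -1"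
     "A 4 3 = 1" "A 4 4 = 1" "A 4 5 = 1" "A 5 2 = -1" "A 5 3 = 1" "A 5 4 = -1" "A 5 5 = 1"
    and inv: "\<And>m. m \<in> {1..4} \<Longrightarrow> lead_invertible A m" and piv: "completely_pivoted 5 A"
    and S2: "schur A 2 3 2 = schur A 2 2 2" "schur A 2 3 4 = - schur A 2 2 2"
     "schur A 2 4 3 = schur A 2 2 2" "schur A 2 5 2 = - schur A 2 2 2"
    and S3: "schur A 3 3 5 = - schur A 3 3 3" "schur A 3 4 3 = schur A 3 3 3" "schur A 3 5 4 = - schur A 3 3 3"
    and S4: "schur A 4 4 5 = schur A 4 4 4" "schur A 4 5 4 = - schur A 4 4 4" "schur A 4 5 5 = schur A 4 4 4"
    using assms(1) unfolding S5_def by auto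
  have cp: "\<bar>schur A k i j\<bar> \<le> \<bar>schur A k k k\<bar>" if "k \<in> {1..4}" "i \<in> {k..5}" "j \<in> {k..5}" for k i j
    using piv that by (auto simp: completely_pivoted_def)
  define p q where "p = schur A 2 2 2" and "q = schur A 3 3 3"
  define b d x y where "b = A 1 3" and "d = A 1 5" and "x = A 2 1" and "y = A 4 1"
  define e f h where "e = schur A 2 2 3" and "f = schur A 2 2 4" and "h = schur A 2 2 5"
  define m w where "m = schur A 2 4 2 / p" and "w = schur A 3 5 3 / q"
  have nz: "p \<noteq> 0" "q \<noteq> 0" "s \<noteq> 0"
    using pivot_nonzero[of A 1] pivot_nonzero[of A 2] pivot_nonzero[of A 3] inv
    by (auto simp: p_def q_def s_def)
  have B: "schur A 2 i j = A i j - A i 1 * A 1 j" for i j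
    using schur_step[of 1 A i j] inv A by simp
  have C: "schur A 3 i j = schur A 2 i j - schur A 2 i 2 * schur A 2 2 j / p" for i j
    using schur_step[of 2 A i j] inv by (simp add: p_def)
  have D: "schur A 4 i j = schur A 3 i j - schur A 3 i 3 * schur A 3 3 j / q" for i j
    using schur_step[of 3 A i j] inv by (simp add: q_def)
  show "schur A 5 5 5 = 2 * s"
    using schur_step[of 4 A 5 5] inv S4 nz by (simp add: s_def)
  have C3: "schur A 3 3 j = schur A 2 3 j - schur A 2 2 j" for j
    using C[of 3 j] S2 nz by (simp add: p_def)
  have C4: "schur A 3 4 j = schur A 2 4 j - m * schur A 2 2 j" for j
    using C[of 4 j] by (simp add: m_def)
  have C5: "schur A 3 5 j = schur A 2 5 j + schur A 2 2 j" for j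
    using C[of 5 j] S2 nz by (simp add: p_def)
  have D4: "schur A 4 4 j = schur A 3 4 j - schur A 3 3 j" for j
    using D[of 4 j] S3 nz by (simp add: q_def)
  have D5: "schur A 4 5 j = schur A 3 5 j - w * schur A 3 3 j" for j
    using D[of 5 j] by (simp add: w_def)
  have z: "A 5 1 = p - 1" using B[of 5 2] S2 A by (simp add: p_def)
  have pc: "p = 1 - c" using B[of 3 4] S2 A by (simp add: p_def c_def)
  have f: "f = - 1 - x * c" using B[of 2 4] A by (simp add: f_def x_def c_def)
  have h: "h = 1 - x * d" using B[of 2 5] A by (simp add: h_def x_def d_def)
  have yb: "y * b = c" using B[of 4 3] S2 A pc by (simp add: p_def b_def y_def)
  have B34: "schur A 2 3 4 = - p" using S2 by (simp add: p_def)
  have B35: "schur A 2 3 5 = d - 1" using B[of 3 5] A by (simp add: d_def)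
  have B43: "schur A 2 4 3 = p" using S2 by (simp add: p_def)
  have B44: "schur A 2 4 4 = 1 - y * c" using B[of 4 4] A by (simp add: y_def c_def)
  have B45: "schur A 2 4 5 = 1 - y * d" using B[of 4 5] A by (simp add: y_def d_def)
  have B53: "schur A 2 5 3 = 1 + c * b" using B[of 5 3] A z pc by (simp add: b_def)
  have B54: "schur A 2 5 4 = c * c - 1" using B[of 5 4] A z pc by (simp add: c_def)
  have B55: "schur A 2 5 5 = 1 + c * d" using B[of 5 5] A z pc by (simp add: d_def)
  have q: "q = 2 + x * c - c\<^sup>2"
    using C5[of 4] S3 B54 f by (simp add: q_def f_def power2_eq_square)
  have qp: "\<bar>q\<bar> \<le> 2 * \<bar>p\<bar>"
    using C3[of 3] cp[of 2 3 3] cp[of 2 2 3] by (simp add: q_def p_def)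
  have d: "d * (1 + x) = c * (c - x)"
    using C3[of 5] S3 B35 h q by (simp add: q_def [symmetric] h_def [symmetric] algebra_simps power2_eq_square)
  have me: "m * e = p - q" using C4[of 3] S3 B43 by (simp add: q_def e_def)
  have C53: "schur A 3 5 3 = 1 + c * b + e" using C5[of 3] B53 by (simp add: e_def)
  then have w1: "w * q = 1 + c * b + e" using nz by (simp add: w_def)
  have w2: "w * (c * (1 + x)) = s - q"
  proof -
    have "- s = - q - w * (- p - f)"
      using D5[of 4] S3 S4 C3[of 4] B34 by (simp add: s_def q_def f_def)
    then show ?thesis unfolding pc f by (simp add: algebra_simps)
  qed
  have s55: "3 + (c - x) * d + c * b + e = s"
  proof -
    have "s = (1 + c * d) + h + w * q"
      using D5[of 5] S3 S4 C5[of 5] B55 by (simp add: s_def q_def h_def)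
    then show ?thesis unfolding w1 h by (simp add: algebra_simps)
  qed
  have s44: "y * c + m * f = 1 - c - x * c - s"
  proof -
    have "s = (1 - y * c - m * f) - (- p - f)"
      using D4[of 4] C4[of 4] C3[of 4] B44 B34 by (simp add: s_def f_def)
    then show ?thesis by (simp add: pc f)
  qed
  have s45: "y * d + m * h = 1 + q - s"
    using D4[of 5] S3 S4 C4[of 5] B45 by (simp add: s_def q_def h_def)
  have xb: "-1 \<le> x" "x \<le> 1" and cb: "-1 \<le> c" "c \<le> 1"
    using cp[of 1 2 1] cp[of 1 1 4] A by (auto simp: x_def c_def)
  note E = curve_of_elimination[OF cb xb pc nz(1) yb q qp d f h me w1 w2 s55 s44 s45]
  show "0 \<le> s" by (rule E)
  show "2 < s \<Longrightarrow> -1 < c \<and> c < 0 \<and> c * (1 + c) + (s - 2) / 2 * (2 - c * (1 + c)) < 0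
           \<and> curveF c ((s - 2) / 2) = 0"
    by (rule E)
  show "\<bar>schur A 2 2 2\<bar> \<le> 2" using cb pc by (simp add: p_def)
  then show "\<bar>schur A 3 3 3\<bar> \<le> 4" using qp by (simp add: p_def q_def)
qed

section \<open>The extremal matrix and its pivoting inequalities\<close>

lemma mult_bounds:
  fixes x y :: real
  assumes "a \<le> x" "x \<le> a'" "b \<le> y" "y \<le> b'" "0 \<le> a" "0 \<le> b"
  shows "a * b \<le> x * y" "x * y \<le> a' * b'"
  using assms by (auto intro!: mult_mono)

lemma divide_bounds:
  fixes x y :: real
  assumes "a \<le> x" "x \<le> a'" "b \<le> y" "y \<le> b'" "0 \<le> a" "0 < b"
  shows "a / b' \<le> x / y" "x / y \<le> a' / b"
  using assms by (auto intro!: frac_le)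

text \<open>The formulas derived in \<open>curve_of_elimination\<close>, read backwards as
  definitions. The curve equation amounts to \<open>m e = 1 - c - q\<close>; the other seven
  equations are identities in \<open>c\<close> and \<open>k\<close>.\<close>

lemma elimination_of_curve:
  fixes c k :: real
  defines "N \<equiv> c * (1 + c)" defines "v \<equiv> - (k * (2 - N))" defines "t \<equiv> N + k * (2 - N)"
  defines "M \<equiv> (1 - 2 * k) * N - 4 * k\<^sup>2 * (2 - N)"
  defines "m \<equiv> M / N" defines "Y \<equiv> - 1 - 2 * k - t + m * (1 + t - c)"
  defines "b \<equiv> c\<^sup>2 / Y" defines "d \<equiv> v * c / t" defines "x \<equiv> t / c - 1" defines "y \<equiv> Y / c"
  defines "s \<equiv> 2 + 2 * k" defines "e \<equiv> s - 3 - v\<^sup>2 / t - c * b" defines "q \<equiv> 2 - v"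
  assumes F: "curveF c k = 0" and nz: "c \<noteq> 0" "N \<noteq> 0" "t \<noteq> 0" "Y \<noteq> 0" "q \<noteq> 0"
  shows "y * b = c" "q = 2 + x * c - c\<^sup>2" "d * (1 + x) = c * (c - x)" "m * e = 1 - c - q"
    "(1 + c * b + e) / q * (c * (1 + x)) = s - q" "3 + (c - x) * d + c * b + e = s"
    "y * c + m * (- 1 - x * c) = 1 - c - x * c - s" "y * d + m * (1 - x * d) = 1 + q - s"
proof -
  have tv: "t + v = N" by (simp add: t_def v_def)
  have xc: "x * c = t - c" using nz by (simp add: x_def field_simps)
  have cx: "c * (c - x) = v" using xc tv by (simp add: N_def algebra_simps)
  have ct: "c * (1 + x) = t" using xc by (simp add: algebra_simps)
  have dt: "d * t = v * c" using nz by (simp add: d_def)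
  have yc: "y * c = Y" using nz by (simp add: y_def)
  have bY: "b * Y = c\<^sup>2" using nz by (simp add: b_def)
  have mN: "m * N = M" using nz by (simp add: m_def)
  have cxd: "(c - x) * d = v\<^sup>2 / t"
  proof -
    have "(c - x) * d * t = (c * (c - x)) * v" using dt by (simp add: mult.assoc mult.left_commute)
    then show ?thesis using nz by (simp add: cx field_simps power2_eq_square)
  qed
  show "y * b = c" using nz by (simp add: y_def b_def field_simps power2_eq_square)
  show "q = 2 + x * c - c\<^sup>2" using xc tv by (simp add: q_def N_def algebra_simps power2_eq_square)
  show "d * (1 + x) = c * (c - x)"
  proof -
    have "c * (d * (1 + x)) = d * (c * (1 + x))" by (rule mult.left_commute)
    also have "\<dots> = c * v" unfolding ct dt by (rule mult.commute)
    finally show ?thesis using nz cx by simp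
  qed
  show "3 + (c - x) * d + c * b + e = s" by (simp add: cxd e_def)
  show "y * c + m * (- 1 - x * c) = 1 - c - x * c - s"
    unfolding yc xc Y_def s_def by (simp add: algebra_simps)
  have et: "e * t = (2 * k - 1) * t - v\<^sup>2 - c * b * t"
    using nz by (simp add: e_def s_def field_simps)
  show "m * e = 1 - c - q"
  proof -
    define Z where "Z = N * (- 1 - 2 * k - t) + M * (1 + t - c)"
    have Z: "Z = Y * N" unfolding Z_def Y_def mN [symmetric] by (simp add: algebra_simps)
    have "M * c ^ 3 * t * N - Z * (M * ((2 * k - 1) * t - v ^ 2) + N * t * (1 + c - v)) = 0"
      using F unfolding curveF_def Let_def Z_def M_def v_def t_def N_def by simp
    then have "N\<^sup>2 * (m * c ^ 3 * t - Y * (m * ((2 * k - 1) * t - v\<^sup>2) + t * (1 + c - v))) = 0"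
      unfolding Z mN [symmetric] by (simp add: algebra_simps power2_eq_square)
    then have *: "m * c ^ 3 * t = Y * (m * ((2 * k - 1) * t - v\<^sup>2) + t * (1 + c - v))"
      using nz by simp
    have "Y * t * (m * e) = m * (Y * (e * t))" by simp
    also have "\<dots> = Y * (m * ((2 * k - 1) * t - v\<^sup>2)) - m * c * t * (b * Y)"
      unfolding et by (simp add: algebra_simps)
    also have "\<dots> = Y * t * (1 - c - q)"
      using * unfolding bY q_def by (simp add: algebra_simps power2_eq_square power3_eq_cube)
    finally show ?thesis using nz by simp
  qed
  show "(1 + c * b + e) / q * (c * (1 + x)) = s - q"
  proof -
    have "(1 + c * b + e) * t = 2 * k * t - v\<^sup>2"
      using et by (simp add: algebra_simps)
    also have "\<dots> = (s - q) * q"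
    proof -
      have "k * (t + v - 2) = v" unfolding tv by (simp add: v_def algebra_simps)
      then show ?thesis unfolding s_def q_def by (simp add: algebra_simps power2_eq_square)
    qed
    finally show ?thesis using nz by (simp add: ct)
  qed
  show "y * d + m * (1 - x * d) = 1 + q - s"
  proof -
    have 1: "y * d * t = Y * v"
    proof -
      have "y * d * t = y * (d * t)" by simp
      then show ?thesis unfolding dt yc [symmetric] by (simp only: mult_ac)
    qed
    have 2: "x * d * t = (t - c) * v"
    proof -
      have "x * d * t = x * (d * t)" by simp
      then show ?thesis unfolding dt xc [symmetric] by (simp only: mult_ac)
    qed
    have M: "m * (t + v) = (1 - 2 * k) * t + (1 + 2 * k) * v"
      unfolding tv mN unfolding M_def t_def v_def by (simp add: algebra_simps power2_eq_square)
    have "(y * d + m * (1 - x * d)) * t = y * d * t + m * (t - x * d * t)"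
      by (simp add: algebra_simps)
    also have "\<dots> = Y * v + m * (t - (t - c) * v)" unfolding 1 2 ..
    also have "\<dots> = (1 + q - s) * t"
      using M unfolding Y_def q_def s_def by (simp add: algebra_simps)
    finally show ?thesis using nz by simp
  qed
qed

text \<open>\<open>u\<close>, \<open>n\<close>, \<open>\<kappa>\<close>, \<open>\<tau>\<close> stand
  for \<open>- c\<close>, \<open>- N\<close>, \<open>- v\<close>, \<open>- t\<close>. All of them
  are positive, so products and quotients can be bounded endpoint by endpoint. The ranges of
  \<open>u\<close> and \<open>k\<close> are the window and the enclosure of \<open>K / 2\<close>,
  rounded outward, as are all derived bounds.\<close>

lemma witness_bounds:
  fixes u k :: real
  assumes u: "453125/1000000 \<le> u" "u \<le> 453370/1000000" and k: "331292/10000000 \<le> k" "k \<le> 331293/10000000"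
  defines "n \<equiv> u * (1 - u)" defines "\<kappa> \<equiv> k * (2 + n)" defines "\<tau> \<equiv> n - \<kappa>"
  defines "m \<equiv> 1 - 2 * k + 4 * k\<^sup>2 * (2 + n) / n"
  defines "Y \<equiv> m * (1 - \<tau> + u) - 1 - 2 * k + \<tau>" defines "b \<equiv> u\<^sup>2 / Y"
  shows "247691/1000000 \<le> n" "n \<le> 247937/1000000" "744642/10000000 \<le> \<kappa>" "\<kappa> \<le> 744726/10000000"
    "973540/1000000 \<le> m" "m \<le> 973586/1000000"
    "352752/1000000 \<le> Y" "Y \<le> 353553/1000000" "580739/1000000 \<le> b" "b \<le> 582688/1000000"
    "31964/1000000 \<le> \<kappa>\<^sup>2 / \<tau>" "\<kappa>\<^sup>2 / \<tau> \<le> 32019/1000000"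
    "263147/1000000 \<le> u * b" "u * b \<le> 264174/1000000"
    "382068/1000000 \<le> \<tau> / u" "\<tau> / u \<le> 382837/1000000"
    "429255/1000000 \<le> \<kappa> / \<tau>" "\<kappa> / \<tau> \<le> 429935/1000000"
    "194506/1000000 \<le> \<kappa> / \<tau> * u" "\<kappa> / \<tau> * u \<le> 194920/1000000"
    "778066/1000000 \<le> Y / u" "Y / u \<le> 780255/1000000"
    "151420/1000000 \<le> Y * (\<kappa> / \<tau>)" "Y * (\<kappa> / \<tau>) \<le> 152005/1000000"
    "358410/1000000 \<le> (1 - \<tau> / u) * b" "(1 - \<tau> / u) * b \<le> 360062/1000000"
proof -
  show n: "247691/1000000 \<le> n" "n \<le> 247937/1000000"
    using mult_bounds[OF u, of "546630/1000000" "1 - u" "546875/1000000"] u by (simp_all add: n_def)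
  show \<kappa>: "744642/10000000 \<le> \<kappa>" "\<kappa> \<le> 744726/10000000"
    using mult_bounds[OF k, of "2247691/1000000" "2 + n" "2247937/1000000"] n by (simp_all add: \<kappa>_def)
  have \<tau>: "1732184/10000000 \<le> \<tau>" "\<tau> \<le> 1734728/10000000"
    using n \<kappa> by (simp_all add: \<tau>_def)
  \<comment> \<open>\<open>4 k^2 (2 + n) / n\<close> is bounded as
    \<open>4 (k \<kappa>) / n\<close>, which reuses the bounds on \<open>\<kappa>\<close>; the
    denominator 4000000 below absorbs the factor 4.\<close>
  have "331292/10000000 * (744642/10000000) \<le> k * \<kappa>" "k * \<kappa> \<le> 331293/10000000 * (744726/10000000)"
    using mult_bounds[OF k \<kappa>] by simp_all
  note r' = divide_bounds[OF this n]
  have r: "39799/4000000 \<le> (k * \<kappa>) / n" "(k * \<kappa>) / n \<le> 39844/4000000"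
    by (rule order_trans[OF _ r'(1)] order_trans[OF r'(2)]; simp)+
  have "m = 1 - 2 * k + 4 * ((k * \<kappa>) / n)" by (simp add: m_def \<kappa>_def power2_eq_square mult.assoc)
  then show m: "973540/1000000 \<le> m" "m \<le> 973586/1000000"
    using r k by simp_all
  show Y: "352752/1000000 \<le> Y" "Y \<le> 353553/1000000"
    using mult_bounds[OF m, of "1 - 1734728/10000000 + 453125/1000000" "1 - \<tau> + u" "1 - 1732184/10000000 + 453370/1000000"]
      \<tau> u k by (simp_all add: Y_def)
  have u2: "453125/1000000 * (453125/1000000) \<le> u\<^sup>2" "u\<^sup>2 \<le> 453370/1000000 * (453370/1000000)"
    using mult_bounds[OF u u] by (simp_all add: power2_eq_square)
  show b: "580739/1000000 \<le> b" "b \<le> 582688/1000000"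
    using divide_bounds[OF u2 Y] by (simp_all add: b_def)
  have \<kappa>2: "744642/10000000 * (744642/10000000) \<le> \<kappa>\<^sup>2" "\<kappa>\<^sup>2 \<le> 744726/10000000 * (744726/10000000)"
    using mult_bounds[OF \<kappa> \<kappa>] by (simp_all add: power2_eq_square)
  show "31964/1000000 \<le> \<kappa>\<^sup>2 / \<tau>" "\<kappa>\<^sup>2 / \<tau> \<le> 32019/1000000"
    by (rule order_trans[OF _ divide_bounds(1)[OF \<kappa>2 \<tau>]] order_trans[OF divide_bounds(2)[OF \<kappa>2 \<tau>]]; simp)+
  show "263147/1000000 \<le> u * b" "u * b \<le> 264174/1000000"
    using mult_bounds[OF u b] by simp_all
  show tu: "382068/1000000 \<le> \<tau> / u" "\<tau> / u \<le> 382837/1000000"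
    by (rule order_trans[OF _ divide_bounds(1)[OF \<tau> u]] order_trans[OF divide_bounds(2)[OF \<tau> u]]; simp)+
  show kt: "429255/1000000 \<le> \<kappa> / \<tau>" "\<kappa> / \<tau> \<le> 429935/1000000"
    by (rule order_trans[OF _ divide_bounds(1)[OF \<kappa> \<tau>]] order_trans[OF divide_bounds(2)[OF \<kappa> \<tau>]]; simp)+
  show "194506/1000000 \<le> \<kappa> / \<tau> * u" "\<kappa> / \<tau> * u \<le> 194920/1000000"
    by (rule order_trans[OF _ mult_bounds(1)[OF kt u]] order_trans[OF mult_bounds(2)[OF kt u]]; simp)+
  show "778066/1000000 \<le> Y / u" "Y / u \<le> 780255/1000000"
    by (rule order_trans[OF _ divide_bounds(1)[OF Y u]] order_trans[OF divide_bounds(2)[OF Y u]]; simp)+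
  show "151420/1000000 \<le> Y * (\<kappa> / \<tau>)" "Y * (\<kappa> / \<tau>) \<le> 152005/1000000"
    by (rule order_trans[OF _ mult_bounds(1)[OF Y kt]] order_trans[OF mult_bounds(2)[OF Y kt]]; simp)+
  show "358410/1000000 \<le> (1 - \<tau> / u) * b" "(1 - \<tau> / u) * b \<le> 360062/1000000"
  proof -
    have "617163/1000000 \<le> 1 - \<tau> / u" "1 - \<tau> / u \<le> 617932/1000000" using tu by simp_all
    note * = mult_bounds[OF this b]
    show "358410/1000000 \<le> (1 - \<tau> / u) * b" "(1 - \<tau> / u) * b \<le> 360062/1000000"
      by (rule order_trans[OF _ *(1)] order_trans[OF *(2)]; simp)+
  qed
qed

lemma lead_invertible_step:
  "1 \<le> k \<Longrightarrow> lead_invertible A (k - 1) \<Longrightarrow> schur A k k k \<noteq> 0 \<Longrightarrow> lead_invertible A k"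
  using lead_invertible_Suc[of A "k - 1"] by simp

text \<open>\<open>le1\<close>, \<open>le2\<close>, \<open>le3\<close> collect the inequalities of
  the first three pivoting steps that do not follow from the prescribed equalities. In the fourth
  step all entries are \<open>s\<close> or \<open>- s\<close>.\<close>

lemma matrix_of_elimination:
  fixes b c d e m p q s x y :: real
  assumes p: "p = 1 - c" and yb: "y * b = c" and q: "q = 2 + x * c - c\<^sup>2"
    and d: "d * (1 + x) = c * (c - x)" and me: "m * e = 1 - c - q"
    and w: "(1 + c * b + e) / q * (c * (1 + x)) = s - q" and s55: "3 + (c - x) * d + c * b + e = s"
    and s44: "y * c + m * (- 1 - x * c) = 1 - c - x * c - s" and s45: "y * d + m * (1 - x * d) = 1 + q - s"
    and pos: "0 < p" "0 < q" "0 < s"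
    and le1: "\<bar>b\<bar> \<le> 1" "\<bar>c\<bar> \<le> 1" "\<bar>d\<bar> \<le> 1" "\<bar>x\<bar> \<le> 1" "\<bar>y\<bar> \<le> 1" "\<bar>p + x\<bar> \<le> 1" "\<bar>e + x * b\<bar> \<le> 1"
      "\<bar>q + e - b\<bar> \<le> 1" "\<bar>m * p + y\<bar> \<le> 1"
    and le2: "\<bar>e\<bar> \<le> p" "\<bar>- 1 - x * c\<bar> \<le> p" "\<bar>1 - x * d\<bar> \<le> p" "\<bar>q + e\<bar> \<le> p" "\<bar>d - 1\<bar> \<le> p" "\<bar>m * p\<bar> \<le> p"
      "\<bar>1 - y * c\<bar> \<le> p" "\<bar>1 - y * d\<bar> \<le> p" "\<bar>1 + c * b\<bar> \<le> p" "\<bar>c\<^sup>2 - 1\<bar> \<le> p" "\<bar>1 + c * d\<bar> \<le> p"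
    and le3: "\<bar>c * (1 + x)\<bar> \<le> q" "\<bar>s + c * (1 + x)\<bar> \<le> q" "\<bar>s - q\<bar> \<le> q" "\<bar>1 + c * b + e\<bar> \<le> q"
      "\<bar>s - (1 + c * b + e)\<bar> \<le> q"
  shows "\<exists>A\<in>S5. schur A 5 5 5 = 2 * s"
proof -
  \<comment> \<open>Undoing the first elimination step on the prescribed \<open>A^(2)\<close>: entry
    22 is \<open>p + x\<close>, entry 33 is \<open>q + e - b\<close>, and entry 51 is
    \<open>p - 1 = - c\<close>. Lists count from 0, hence \<open>i - 1\<close> and
    \<open>j - 1\<close>.\<close>
  define A :: rmat where "A i j = [[1, 1, b, c, d], [x, p + x, e + x * b, - 1, 1], [- 1, p - 1, q + e - b, - 1, - 1],
    [y, m * p + y, 1, 1, 1], [- c, - 1, 1, - 1, 1]] ! (i - 1) ! (j - 1)" for i j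
  have A: "A 1 1 = 1" "A 1 2 = 1" "A 1 3 = b" "A 1 4 = c" "A 1 5 = d"
    "A 2 1 = x" "A 2 2 = p + x" "A 2 3 = e + x * b" "A 2 4 = - 1" "A 2 5 = 1"
    "A 3 1 = - 1" "A 3 2 = p - 1" "A 3 3 = q + e - b" "A 3 4 = - 1" "A 3 5 = - 1"
    "A 4 1 = y" "A 4 2 = m * p + y" "A 4 3 = 1" "A 4 4 = 1" "A 4 5 = 1"
    "A 5 1 = - c" "A 5 2 = - 1" "A 5 3 = 1" "A 5 4 = - 1" "A 5 5 = 1"
    by (simp_all add: A_def)
  have i1: "lead_invertible A 1" using lead_invertible_step[of 1 A] A by simp
  have Bij: "schur A 2 i j = A i j - A i 1 * A 1 j" for i j
    using schur_step[of 1 A i j] i1 A by simp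
  have B: "schur A 2 2 2 = p" "schur A 2 2 3 = e" "schur A 2 2 4 = - 1 - x * c" "schur A 2 2 5 = 1 - x * d"
    "schur A 2 3 2 = p" "schur A 2 3 3 = q + e" "schur A 2 3 4 = - p" "schur A 2 3 5 = d - 1"
    "schur A 2 4 2 = m * p" "schur A 2 4 3 = p" "schur A 2 4 4 = 1 - y * c" "schur A 2 4 5 = 1 - y * d"
    "schur A 2 5 2 = - p" "schur A 2 5 3 = 1 + c * b" "schur A 2 5 4 = c\<^sup>2 - 1" "schur A 2 5 5 = 1 + c * d"
    using yb by (simp_all add: Bij A p power2_eq_square)
  have i2: "lead_invertible A 2" using lead_invertible_Suc[of A 1] B i1 pos by simp
  have Cij: "schur A 3 i j = schur A 2 i j - schur A 2 i 2 * schur A 2 2 j / p" for i j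
    using schur_Suc[of A 1 i j] i1 i2 B by simp
  have C: "schur A 3 3 3 = q" "schur A 3 3 4 = c * (1 + x)" "schur A 3 3 5 = - q"
    "schur A 3 4 3 = q" "schur A 3 4 4 = s + c * (1 + x)" "schur A 3 4 5 = s - q"
    "schur A 3 5 3 = 1 + c * b + e" "schur A 3 5 4 = - q" "schur A 3 5 5 = s - (1 + c * b + e)"
  proof -
    have Cr: "schur A 3 3 j = schur A 2 3 j - schur A 2 2 j" "schur A 3 4 j = schur A 2 4 j - m * schur A 2 2 j"
      "schur A 3 5 j = schur A 2 5 j + schur A 2 2 j" for j
      using pos by (simp_all add: Cij B)
    show "schur A 3 3 3 = q" "schur A 3 5 3 = 1 + c * b + e" by (simp_all add: Cr B)
    show "schur A 3 3 4 = c * (1 + x)" by (simp add: Cr B p algebra_simps)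
    show "schur A 3 3 5 = - q" using d by (simp add: Cr B q algebra_simps power2_eq_square)
    show "schur A 3 4 3 = q" using me by (simp add: Cr B p)
    show "schur A 3 4 4 = s + c * (1 + x)" using s44 unfolding Cr B by (simp add: algebra_simps)
    show "schur A 3 4 5 = s - q" using s45 unfolding Cr B by (simp add: algebra_simps)
    show "schur A 3 5 4 = - q" by (simp add: Cr B q algebra_simps)
    show "schur A 3 5 5 = s - (1 + c * b + e)" using s55 unfolding Cr B by (simp add: algebra_simps)
  qed
  have i3: "lead_invertible A 3" using lead_invertible_Suc[of A 2] C i2 pos by simp
  have Dij: "schur A 4 i j = schur A 3 i j - schur A 3 i 3 * schur A 3 3 j / q" for i j
    using schur_Suc[of A 2 i j] i2 i3 C by simp
  have D: "schur A 4 4 4 = s" "schur A 4 4 5 = s" "schur A 4 5 4 = - s" "schur A 4 5 5 = s"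
    using pos w by (simp_all add: Dij C)
  have i4: "lead_invertible A 4" using lead_invertible_Suc[of A 3] D i3 pos by simp
  have E: "schur A 5 5 5 = 2 * s"
    using schur_Suc[of A 3 5 5] i3 i4 D pos by simp
  have inv: "\<forall>k\<in>{1..4}. lead_invertible A k"
  proof
    fix k :: nat assume "k \<in> {1..4}"
    then have "k = 1 \<or> k = 2 \<or> k = 3 \<or> k = 4" by auto
    then show "lead_invertible A k" using i1 i2 i3 i4 by auto
  qed
  have sets: "{1..4} = {1, 2, 3, 4 :: nat}" "{1..5} = {1, 2, 3, 4, 5 :: nat}" "{2..5} = {2, 3, 4, 5 :: nat}"
     "{3..5} = {3, 4, 5 :: nat}" "{4..5} = {4, 5 :: nat}"
    by auto
  have "\<forall>i\<in>{1..5}. \<forall>j\<in>{1..5}. \<bar>schur A 1 i j\<bar> \<le> \<bar>schur A 1 1 1\<bar>"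
  proof -
    have "\<bar>p - 1\<bar> \<le> 1" using le1 p by simp
    with le1 show ?thesis unfolding sets by (simp add: A)
  qed
  moreover have "\<forall>i\<in>{2..5}. \<forall>j\<in>{2..5}. \<bar>schur A 2 i j\<bar> \<le> \<bar>schur A 2 2 2\<bar>"
    using le2 pos(1) unfolding sets B ball_simps by (simp add: B)
  moreover have "\<forall>i\<in>{3..5}. \<forall>j\<in>{3..5}. \<bar>schur A 3 i j\<bar> \<le> \<bar>schur A 3 3 3\<bar>"
    using le3 pos(2) unfolding sets by (simp add: C)
  moreover have "\<forall>i\<in>{4..5}. \<forall>j\<in>{4..5}. \<bar>schur A 4 i j\<bar> \<le> \<bar>schur A 4 4 4\<bar>"
    using pos(3) unfolding sets by (simp add: D)
  ultimately have "completely_pivoted 5 A"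
    unfolding completely_pivoted_def by (simp add: sets(1))
  with inv have "A \<in> S5"
    unfolding S5_def by (simp add: A B C D)
  with E show ?thesis by blast
qed

lemma optimum_attained:
  fixes c k :: real
  assumes c: "-1857/4096 \<le> c" "c \<le> -29/64" and k: "331292/10000000 \<le> k" "k \<le> 331293/10000000"
    and F: "curveF c k = 0"
  shows "\<exists>A\<in>S5. schur A 5 5 5 = 4 + 4 * k"
proof -
  define u where "u = - c"
  have u: "453125/1000000 \<le> u" "u \<le> 453370/1000000" using c by (simp_all add: u_def)
  define N v t M m Y where "N = c * (1 + c)" and "v = - (k * (2 - N))" and "t = N + k * (2 - N)"
    and "M = (1 - 2 * k) * N - 4 * k\<^sup>2 * (2 - N)"
    and "m = M / N" and "Y = - 1 - 2 * k - t + m * (1 + t - c)"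
  define b d x y s e q where "b = c\<^sup>2 / Y" and "d = v * c / t" and "x = t / c - 1" and "y = Y / c"
    and "s = 2 + 2 * k" and "e = s - 3 - v\<^sup>2 / t - c * b" and "q = 2 - v"
  note defs = N_def v_def t_def M_def m_def Y_def b_def d_def x_def y_def s_def e_def q_def
  define n \<kappa> \<tau> where "n = u * (1 - u)" and "\<kappa> = k * (2 + n)" and "\<tau> = n - \<kappa>"
  have N: "N = - n" by (simp add: N_def n_def u_def algebra_simps)
  have v: "v = - \<kappa>" by (simp add: v_def N \<kappa>_def)
  have t: "t = - \<tau>" by (simp add: t_def N \<tau>_def \<kappa>_def)
  note bd0 = witness_bounds(1-4)[OF u k, folded n_def, folded \<kappa>_def]
  have m: "m = 1 - 2 * k + 4 * k\<^sup>2 * (2 + n) / n"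
    using bd0 by (simp add: m_def M_def N field_simps)
  have Y: "Y = m * (1 - \<tau> + u) - 1 - 2 * k + \<tau>" by (simp add: Y_def t u_def)
  have b: "b = u\<^sup>2 / Y" by (simp add: b_def u_def)
  note bd = witness_bounds[OF u k, folded n_def, folded \<kappa>_def, folded \<tau>_def m, folded Y, folded b]
  have d: "d = - (\<kappa> / \<tau> * u)" by (simp add: d_def v t u_def)
  have x: "x = \<tau> / u - 1" by (simp add: x_def t u_def)
  have y: "y = - (Y / u)" by (simp add: y_def u_def)
  have e: "e = 2 * k - 1 + \<kappa>\<^sup>2 / \<tau> + u * b" by (simp add: e_def s_def v t u_def)
  have \<tau>: "\<tau> > 0" using bd(2-4) bd(1) by (simp add: \<tau>_def)
  have nz: "c \<noteq> 0" "N \<noteq> 0" "t \<noteq> 0" "Y \<noteq> 0" "q \<noteq> 0"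
    using c bd \<tau> by (auto simp: N t q_def v)
  note E = elimination_of_curve[OF F, folded N_def, folded v_def t_def M_def, folded m_def, folded Y_def,
      folded b_def d_def x_def y_def s_def, folded e_def q_def, OF nz]
  have yc: "y * c = Y" and yd: "y * d = Y * (\<kappa> / \<tau>)" and xc: "x * c = u - \<tau>" and xb: "x * b = - ((1 - \<tau> / u) * b)"
    and ct: "c * (1 + x) = - \<tau>" and cb: "c * b = - (u * b)"
    using u by (simp_all add: y d x u_def field_simps)
  have cd: "0 \<le> c * d" "c * d \<le> 1 / 5"
  proof -
    have "c * d = u * (\<kappa> / \<tau> * u)" by (simp add: d u_def)
    moreover note mult_bounds[OF u bd(19,20)]
    ultimately show "0 \<le> c * d" "c * d \<le> 1 / 5" by linarith+
  qed
  have xd: "0 \<le> x * d" "x * d \<le> 1 / 5"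
  proof -
    have *: "617163/1000000 \<le> 1 - \<tau> / u" "1 - \<tau> / u \<le> 617932/1000000" using bd(15,16) by linarith+
    have "(a - 1) * - z = (1 - a) * z" for a z :: real by (simp add: algebra_simps)
    then have "x * d = (1 - \<tau> / u) * (\<kappa> / \<tau> * u)" unfolding x d .
    moreover note mult_bounds[OF * bd(19,20)]
    ultimately show "0 \<le> x * d" "x * d \<le> 1 / 5" by linarith+
  qed
  have mp: "1414/1000 \<le> m * (1 - c)" "m * (1 - c) \<le> 1416/1000"
    using mult_bounds[OF bd(5,6), of "1453125/1000000" "1 - c" "1453370/1000000"] u by (simp_all add: u_def)
  have c2: "0 \<le> c\<^sup>2" "c\<^sup>2 \<le> 1/4"
    using mult_bounds[OF u u] by (simp_all add: u_def power2_eq_square)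
  have cu: "c = - u" by (simp add: u_def)
  have "\<exists>A\<in>S5. schur A 5 5 5 = 2 * s"
  proof (rule matrix_of_elimination[OF refl E])
    show "0 < 1 - c" "0 < q" "0 < s" using u k bd(3,4) by (auto simp: cu q_def v s_def)
    show "\<bar>b\<bar> \<le> 1" "\<bar>c\<bar> \<le> 1" "\<bar>d\<bar> \<le> 1" "\<bar>x\<bar> \<le> 1" "\<bar>y\<bar> \<le> 1" "\<bar>1 - c + x\<bar> \<le> 1"
      using bd u unfolding d x y cu abs_le_iff by linarith+
    \<comment> \<open>\<open>e + x b\<close> is the tightest case: the enclosures place it only
      between -0.9987 and -0.9959, which dictates their precision.\<close>
    show "\<bar>e + x * b\<bar> \<le> 1" "\<bar>q + e - b\<bar> \<le> 1"
      using bd k unfolding xb e q_def v abs_le_iff by linarith+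
    show "\<bar>m * (1 - c) + y\<bar> \<le> 1" using mp bd unfolding y abs_le_iff by linarith+
    show "\<bar>e\<bar> \<le> 1 - c" "\<bar>q + e\<bar> \<le> 1 - c" "\<bar>d - 1\<bar> \<le> 1 - c"
      using bd k u unfolding e q_def v d cu abs_le_iff by linarith+
    show "\<bar>- 1 - x * c\<bar> \<le> 1 - c" unfolding xc using bd u \<tau> unfolding cu \<tau>_def abs_le_iff by linarith
    show "\<bar>1 - x * d\<bar> \<le> 1 - c" "\<bar>1 + c * d\<bar> \<le> 1 - c" "\<bar>c\<^sup>2 - 1\<bar> \<le> 1 - c"
      using xd cd c2 u unfolding cu abs_le_iff by linarith+
    show "\<bar>m * (1 - c)\<bar> \<le> 1 - c" using mp u unfolding cu abs_le_iff by linarith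
    show "\<bar>1 - y * c\<bar> \<le> 1 - c" "\<bar>1 - y * d\<bar> \<le> 1 - c" "\<bar>1 + c * b\<bar> \<le> 1 - c"
      unfolding yc yd cb using bd u unfolding cu abs_le_iff by linarith+
    show "\<bar>c * (1 + x)\<bar> \<le> q" "\<bar>s + c * (1 + x)\<bar> \<le> q" "\<bar>s - q\<bar> \<le> q"
      unfolding ct q_def v s_def \<tau>_def abs_le_iff using bd k by linarith+
    show "\<bar>1 + c * b + e\<bar> \<le> q" "\<bar>s - (1 + c * b + e)\<bar> \<le> q"
      unfolding cb e q_def v s_def abs_le_iff using bd k by linarith+
  qed
  then show ?thesis by (simp add: s_def)
qed

section \<open>The maximal growth factor\<close>

theorem theorem1:
  shows "\<exists>r::real. 4 < r \<and> r < 5 \<and> poly P5 r = 0 \<and>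
           (\<forall>s::real. 4 < s \<and> s < 5 \<and> poly P5 s = 0 \<longrightarrow> s = r) \<and>
           (\<exists>A\<in>S5. growth_factor 5 A = r) \<and>
           (\<forall>A\<in>S5. growth_factor 5 A \<le> r)"
proof -
  obtain c K where c: "-1857/4096 < c" "c < -29/64" and K: "K_lo \<le> K" "K \<le> K_hi"
    and F: "poly (curve K) c = 0" "poly (pderiv (curve K)) c = 0"
    and max: "\<And>c' K'. -1 < c' \<Longrightarrow> c' < 0 \<Longrightarrow> 0 < K' \<Longrightarrow>
       c' * (1 + c') + K' / 2 * (2 - c' * (1 + c')) < 0 \<Longrightarrow> poly (curve K') c' = 0 \<Longrightarrow> K' \<le> K"
    by (rule optimum_exists) blast
  define r where "r = 4 + 2 * K"
  have r: "4 < r" "r < 5" "poly P5 r = 0"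
    using K P5_of_double_root[OF F] by (auto simp: r_def)
  have upper: "growth_factor 5 A \<le> r" if A: "A \<in> S5" for A
  proof (rule growth_factor_le)
    define s where "s = schur A 4 4 4"
    note P = S5_properties[OF A, folded s_def]
    have s: "s \<le> 2 + K"
    \<comment> \<open>For \<open>s > 2\<close> the matrix yields a point of the curve in the
      admissible region with \<open>K' = s - 2\<close>.\<close>
    proof (cases "2 < s")
      case True
      from P(5)[OF True] True have "s - 2 \<le> K"
        by (intro max[of "A 1 4"]) (auto simp: poly_curve_half)
      then show ?thesis by simp
    qed (use K in simp)
    show "lead_invertible A m" if "m \<in> {1..5 - 1}" for m using A that by (simp add: S5_def)
    show "completely_pivoted 5 A" "A 1 1 = 1" using A by (simp_all add: S5_def)
    show "(2::nat) \<le> 5" by simp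
    show "1 \<le> r" using r by simp
    \<comment> \<open>In absolute value the pivots are 1, at most 2, at most 4, at most
      \<open>2 + K\<close> and at most \<open>4 + 2 K = r\<close>.\<close>
    show "\<bar>schur A k k k\<bar> \<le> r" if "k \<in> {1..5}" for k
    proof -
      have "k = 1 \<or> k = 2 \<or> k = 3 \<or> k = 4 \<or> k = 5" using that by auto
      moreover have "\<bar>schur A 1 1 1\<bar> \<le> r" using A r by (simp add: S5_def)
      moreover have "\<bar>schur A 4 4 4\<bar> \<le> r" using P(4) s r by (simp add: s_def [symmetric] r_def)
      ultimately show ?thesis using P(1-4) s r by (auto simp: r_def)
    qed
  qed
  have "curveF c (K / 2) = 0" using F(1) by (simp add: poly_curve_half)
  then obtain A where A: "A \<in> S5" "schur A 5 5 5 = r"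
    using optimum_attained[of c "K / 2"] c K by (auto simp: r_def)
  have "\<bar>schur A 5 5 5\<bar> \<le> growth_factor 5 A"
    using A(1) by (intro growth_factor_ge_last_pivot) (auto simp: S5_def)
  with upper[OF A(1)] A(2) r have "growth_factor 5 A = r" by simp
  then have "\<exists>A\<in>S5. growth_factor 5 A = r" using A(1) by blast
  with r upper P5_root_unique[OF _ _ _ r] show ?thesis by blast
qed

end
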